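(* Let $(M, \Pi_M)$ and $(N, \Pi_N)$ be two smooth manifolds with $n$-vector fields and let $\phi: M \rightarrow N$ be a smooth map. Then $\phi$ is a $(\Pi_M, \Pi_N)$-map, that is $\phi_* \Pi_M = \Pi_N$, if and only if its graph $$\mathrm{Gr}(\phi) = \{(m, \phi(m)) : m \in M \}$$ is a coisotropic submanifold of $M \times N$ with respect to the $n$-vector field $\Pi_M \oplus (-1)^{n-1} \Pi_N$.
   Context: An $n$-vector field on $M$ is a section $\Pi\in\Gamma(\bigwedge^n TM)$. It induces a bracket on functions, $\{f_1,\ldots,f_n\}=\Pi(df_1,\ldots,df_n)$. For manifolds $(M,\Pi_M)$, $(N,\Pi_N)$ with $n$-vector fields, a smooth map $\phi:M\to N$ is a $(\Pi_M,\Pi_N)$-map, written $\phi_*\Pi_M=\Pi_N$, if $\{\phi^*f_1,\ldots,\phi^*f_n\}_M=\phi^*\{f_1,\ldots,f_n\}_N$ for all $f_i\in C^\infty(N)$; equivalently $\bigwedge^n(T_m\phi)(\Pi_M(m))=\Pi_N(\phi(m))$ for all $m\in M$. A submanifold $C\hookrightarrow M$ is coisotropic with respect to an $n$-vector field $\Pi$ on $M$ if $\Pi_x(\alpha_1,\ldots,\alpha_n)=0$ for all $x\in C$ and all $\alpha_i\in(TC)^0_x=\{\alpha\in T_x^*M:\alpha(v)=0\ \forall v\in T_xC\}$. On $M\times N$, $\Pi_M\oplus(-1)^{n-1}\Pi_N$ denotes the $n$-vector field that is the sum of $\Pi_M$ (along the $M$ factor) and $(-1)^{n-1}\Pi_N$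 (along the $N$ factor), using $T(M\times N)=TM\oplus TN$. *)

theory Defs
  imports "HOL-Analysis.Analysis"
begin

section \<open>Smooth functions on open subsets of normed spaces\<close>

primrec Ck_on :: "nat \<Rightarrow> 'e set \<Rightarrow> ('e::real_normed_vector \<Rightarrow> 'f::real_normed_vector) \<Rightarrow> bool" where
  "Ck_on 0 S f \<longleftrightarrow> continuous_on S f"
| "Ck_on (Suc k) S f \<longleftrightarrow>
     (\<forall>x\<in>S. f differentiable (at x)) \<and> (\<forall>v. Ck_on k S (\<lambda>x. frechet_derivative f (at x) v))"

text \<open>Only meant for open \<open>S\<close> in a finite-dimensional space, where having all directional
  derivatives of class \<open>C^k\<close> is the same as having a derivative of class \<open>C^k\<close>.\<close>

definition smooth_on :: "'e set \<Rightarrow> ('e::real_normed_vector \<Rightarrow> 'f::real_normed_vector) \<Rightarrow> bool" where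
  "smooth_on S f \<longleftrightarrow> (\<forall>k. Ck_on k S f)"


section \<open>Smooth manifolds\<close>

text \<open>A chart is a domain together with a coordinate map, which is a total function whose values
  outside the domain are irrelevant.\<close>

type_synonym ('a, 'e) chart = "'a set \<times> ('a \<Rightarrow> 'e)"

abbreviation chart_image :: "('a, 'e) chart \<Rightarrow> 'e set" where
  "chart_image \<kappa> \<equiv> snd \<kappa> ` fst \<kappa>"

abbreviation chart_inv :: "('a, 'e) chart \<Rightarrow> 'e \<Rightarrow> 'a" where
  "chart_inv \<kappa> \<equiv> inv_into (fst \<kappa>) (snd \<kappa>)"

definition is_chart :: "'a topology \<Rightarrow> ('a, 'e::real_inner) chart \<Rightarrow> bool" where
  "is_chart X \<kappa> \<longleftrightarrow>
     openin X (fst \<kappa>) \<and> open (chart_image \<kappa>) \<and>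
     homeomorphic_map (subtopology X (fst \<kappa>)) (top_of_set (chart_image \<kappa>)) (snd \<kappa>)"

definition compatible :: "('a, 'e::real_inner) chart \<Rightarrow> ('a, 'e) chart \<Rightarrow> bool" where
  "compatible \<kappa> \<kappa>' \<longleftrightarrow>
     smooth_on (snd \<kappa> ` (fst \<kappa> \<inter> fst \<kappa>')) (snd \<kappa>' \<circ> chart_inv \<kappa>) \<and>
     smooth_on (snd \<kappa>' ` (fst \<kappa> \<inter> fst \<kappa>')) (snd \<kappa> \<circ> chart_inv \<kappa>')"

record ('a, 'e) manifold =
  mtop :: "'a topology"
  atlas :: "('a, 'e) chart set"

abbreviation points :: "('a, 'e) manifold \<Rightarrow> 'a set" where
  "points M \<equiv> topspace (mtop M)"

text \<open>The model space is an arbitrary finite-dimensional real inner product space \<open>'e\<close>. The class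
  \<open>euclidean_space\<close> is not used because it requires a nonempty basis, which would exclude
  manifolds of dimension \<open>0\<close>. The atlas need not be maximal.\<close>

definition smooth_manifold :: "('a, 'e::real_inner) manifold \<Rightarrow> bool" where
  "smooth_manifold M \<longleftrightarrow>
     (\<exists>B::'e set. finite B \<and> span B = UNIV) \<and>
     Hausdorff_space (mtop M) \<and> second_countable (mtop M) \<and>
     (\<forall>\<kappa>\<in>atlas M. is_chart (mtop M) \<kappa>) \<and>
     (\<Union>\<kappa>\<in>atlas M. fst \<kappa>) = points M \<and>
     (\<forall>\<kappa>\<in>atlas M. \<forall>\<kappa>'\<in>atlas M. compatible \<kappa> \<kappa>')"

text \<open>The charts of the maximal atlas.\<close>

definition smooth_chart :: "('a, 'e::real_inner) manifold \<Rightarrow> ('a, 'e) chart \<Rightarrow> bool" where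
  "smooth_chart M \<kappa> \<longleftrightarrow> is_chart (mtop M) \<kappa> \<and> (\<forall>\<kappa>'\<in>atlas M. compatible \<kappa> \<kappa>')"

definition smooth_map ::
  "('a, 'e::real_inner) manifold \<Rightarrow> ('b, 'f::real_inner) manifold \<Rightarrow> ('a \<Rightarrow> 'b) \<Rightarrow> bool" where
  "smooth_map M N \<phi> \<longleftrightarrow>
     continuous_map (mtop M) (mtop N) \<phi> \<and>
     (\<forall>\<kappa>\<in>atlas M. \<forall>\<kappa>'\<in>atlas N.
        smooth_on (snd \<kappa> ` {p \<in> fst \<kappa>. \<phi> p \<in> fst \<kappa>'}) (snd \<kappa>' \<circ> \<phi> \<circ> chart_inv \<kappa>))"

definition smooth_functions :: "('a, 'e::real_inner) manifold \<Rightarrow> ('a \<Rightarrow> real) set" where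
  "smooth_functions M = {f. \<forall>\<kappa>\<in>atlas M. smooth_on (chart_image \<kappa>) (f \<circ> chart_inv \<kappa>)}"

definition smooth_curve :: "('a, 'e::real_inner) manifold \<Rightarrow> real \<Rightarrow> (real \<Rightarrow> 'a) \<Rightarrow> bool" where
  "smooth_curve M \<epsilon> \<gamma> \<longleftrightarrow>
     continuous_map (top_of_set {-\<epsilon><..<\<epsilon>}) (mtop M) \<gamma> \<and>
     (\<forall>\<kappa>\<in>atlas M. smooth_on {t \<in> {-\<epsilon><..<\<epsilon>}. \<gamma> t \<in> fst \<kappa>} (snd \<kappa> \<circ> \<gamma>))"

definition prod_chart :: "('a, 'e) chart \<Rightarrow> ('b, 'f) chart \<Rightarrow> ('a \<times> 'b, 'e \<times> 'f) chart" where
  "prod_chart \<kappa> \<kappa>' = (fst \<kappa> \<times> fst \<kappa>', map_prod (snd \<kappa>) (snd \<kappa>'))"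

definition prod_manifold ::
  "('a, 'e) manifold \<Rightarrow> ('b, 'f) manifold \<Rightarrow> ('a \<times> 'b, 'e \<times> 'f) manifold" where
  "prod_manifold M N =
     \<lparr>mtop = prod_topology (mtop M) (mtop N),
      atlas = {prod_chart \<kappa> \<kappa>' | \<kappa> \<kappa>'. \<kappa> \<in> atlas M \<and> \<kappa>' \<in> atlas N}\<rparr>"


section \<open>Tangent and cotangent spaces\<close>

definition charts_at :: "('a, 'e) manifold \<Rightarrow> 'a \<Rightarrow> ('a, 'e) chart set" where
  "charts_at M p = {\<kappa> \<in> atlas M. p \<in> fst \<kappa>}"

definition chart_at :: "('a, 'e) manifold \<Rightarrow> 'a \<Rightarrow> ('a, 'e) chart" where
  "chart_at M p = (SOME \<kappa>. \<kappa> \<in> charts_at M p)"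

text \<open>A tangent vector at \<open>p\<close> is a family of coordinate vectors, one for each chart at \<open>p\<close>, related
  by the derivatives of the transition maps. It is \<open>0\<close> at all other charts, so that
  equality of tangent vectors is equality of functions.\<close>

type_synonym ('a, 'e) tvec = "('a, 'e) chart \<Rightarrow> 'e"

definition tangent_space :: "('a, 'e::real_inner) manifold \<Rightarrow> 'a \<Rightarrow> ('a, 'e) tvec set" where
  "tangent_space M p = {v.
     (\<forall>\<kappa>. \<kappa> \<notin> charts_at M p \<longrightarrow> v \<kappa> = 0) \<and>
     (\<forall>\<kappa>\<in>charts_at M p. \<forall>\<kappa>'\<in>charts_at M p.
        v \<kappa>' = frechet_derivative (snd \<kappa>' \<circ> chart_inv \<kappa>) (at (snd \<kappa> p)) (v \<kappa>))}"

text \<open>The tangent map of \<open>\<phi>\<close> at \<open>p\<close>; the result does not depend on the chosen chart at \<open>p\<close>.\<close>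

definition tangent_map ::
  "('a, 'e::real_inner) manifold \<Rightarrow> ('b, 'f::real_inner) manifold \<Rightarrow> ('a \<Rightarrow> 'b) \<Rightarrow> 'a
     \<Rightarrow> ('a, 'e) tvec \<Rightarrow> ('b, 'f) tvec" where
  "tangent_map M N \<phi> p v = (\<lambda>\<kappa>'.
     if \<kappa>' \<in> charts_at N (\<phi> p)
     then let \<kappa> = chart_at M p
          in frechet_derivative (snd \<kappa>' \<circ> \<phi> \<circ> chart_inv \<kappa>) (at (snd \<kappa> p)) (v \<kappa>)
     else 0)"

text \<open>Covectors are linear functionals on the tangent space, extended by \<open>0\<close> outside of it so that
  equality of covectors is equality of functions.\<close>

type_synonym ('a, 'e) covec = "('a, 'e) tvec \<Rightarrow> real"

definition cotangent_space :: "('a, 'e::real_inner) manifold \<Rightarrow> 'a \<Rightarrow> ('a, 'e) covec set" where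
  "cotangent_space M p = {\<alpha>.
     (\<forall>v\<in>tangent_space M p. \<forall>w\<in>tangent_space M p. \<forall>a b.
        \<alpha> (\<lambda>\<kappa>. a *\<^sub>R v \<kappa> + b *\<^sub>R w \<kappa>) = a * \<alpha> v + b * \<alpha> w) \<and>
     (\<forall>v. v \<notin> tangent_space M p \<longrightarrow> \<alpha> v = 0)}"

text \<open>The differential at \<open>p\<close> of a real function defined and smooth near \<open>p\<close>; again independent of
  the chosen chart at \<open>p\<close>.\<close>

definition differential ::
  "('a, 'e::real_inner) manifold \<Rightarrow> ('a \<Rightarrow> real) \<Rightarrow> 'a \<Rightarrow> ('a, 'e) covec" where
  "differential M f p = (\<lambda>v.
     if v \<in> tangent_space M p
     then let \<kappa> = chart_at M p
          in frechet_derivative (f \<circ> chart_inv \<kappa>) (at (snd \<kappa> p)) (v \<kappa>)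
     else 0)"

definition pullback_covec ::
  "('a, 'e::real_inner) manifold \<Rightarrow> ('b, 'f::real_inner) manifold \<Rightarrow> ('a \<Rightarrow> 'b) \<Rightarrow> 'a
     \<Rightarrow> ('b, 'f) covec \<Rightarrow> ('a, 'e) covec" where
  "pullback_covec M N \<phi> p \<alpha> = (\<lambda>v.
     if v \<in> tangent_space M p then \<alpha> (tangent_map M N \<phi> p v) else 0)"


section \<open>Multivector fields\<close>

text \<open>Since \<open>T\<^sub>pM\<close> is finite-dimensional, its \<open>n\<close>-th exterior power is identified with the space of
  alternating \<open>n\<close>-linear forms on the cotangent space at \<open>p\<close>. The arguments of such a form are
  given as a list of length \<open>n\<close>; its values on other lists are irrelevant.\<close>

definition multivector ::
  "('a, 'e::real_inner) manifold \<Rightarrow> nat \<Rightarrow> 'a \<Rightarrow> (('a, 'e) covec list \<Rightarrow> real) \<Rightarrow> bool" where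
  "multivector M n p \<omega> \<longleftrightarrow>
     (\<forall>\<alpha>s i \<beta> \<gamma> a b.
        length \<alpha>s = n \<and> set \<alpha>s \<subseteq> cotangent_space M p \<and> i < n \<and>
        \<beta> \<in> cotangent_space M p \<and> \<gamma> \<in> cotangent_space M p \<longrightarrow>
        \<omega> (\<alpha>s[i := (\<lambda>v. a * \<beta> v + b * \<gamma> v)]) = a * \<omega> (\<alpha>s[i := \<beta>]) + b * \<omega> (\<alpha>s[i := \<gamma>])) \<and>
     (\<forall>\<alpha>s i j.
        length \<alpha>s = n \<and> set \<alpha>s \<subseteq> cotangent_space M p \<and>
        i < n \<and> j < n \<and> i \<noteq> j \<and> \<alpha>s ! i = \<alpha>s ! j \<longrightarrow> \<omega> \<alpha>s = 0)"

type_synonym ('a, 'e) mvfield = "'a \<Rightarrow> ('a, 'e) covec list \<Rightarrow> real"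

text \<open>Smoothness of the section: in each chart of the atlas, the coefficients with respect to the
  linear coordinates \<open>q \<mapsto> b \<bullet> \<kappa>(q)\<close> are smooth.\<close>

definition multivector_field ::
  "('a, 'e::real_inner) manifold \<Rightarrow> nat \<Rightarrow> ('a, 'e) mvfield \<Rightarrow> bool" where
  "multivector_field M n P \<longleftrightarrow>
     (\<forall>p\<in>points M. multivector M n p (P p)) \<and>
     (\<forall>\<kappa>\<in>atlas M. \<forall>bs::'e list. length bs = n \<longrightarrow>
        smooth_on (chart_image \<kappa>)
          ((\<lambda>p. P p (map (\<lambda>b. differential M (\<lambda>q. b \<bullet> snd \<kappa> q) p) bs)) \<circ> chart_inv \<kappa>))"

definition bracket ::
  "('a, 'e::real_inner) manifold \<Rightarrow> ('a, 'e) mvfield \<Rightarrow> ('a \<Rightarrow> real) list \<Rightarrow> 'a \<Rightarrow> real" where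
  "bracket M P fs = (\<lambda>p. P p (map (\<lambda>f. differential M f p) fs))"

text \<open>\<open>\<phi>\<close> is a \<open>(P\<^sub>M, P\<^sub>N)\<close>-map.\<close>

definition multivector_map ::
  "nat \<Rightarrow> ('a, 'e::real_inner) manifold \<Rightarrow> ('a, 'e) mvfield
     \<Rightarrow> ('b, 'f::real_inner) manifold \<Rightarrow> ('b, 'f) mvfield \<Rightarrow> ('a \<Rightarrow> 'b) \<Rightarrow> bool" where
  "multivector_map n M PM N PN \<phi> \<longleftrightarrow>
     (\<forall>fs. length fs = n \<and> set fs \<subseteq> smooth_functions N \<longrightarrow>
        (\<forall>m\<in>points M. bracket M PM (map (\<lambda>f. f \<circ> \<phi>) fs) m = bracket N PN fs (\<phi> m)))"

definition scale_mvfield :: "real \<Rightarrow> ('a, 'e) mvfield \<Rightarrow> ('a, 'e) mvfield" where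
  "scale_mvfield c P = (\<lambda>p \<alpha>s. c * P p \<alpha>s)"

text \<open>At \<open>(x, y)\<close> the summands of \<open>T(M \<times> N) = TM \<oplus> TN\<close> are embedded by the tangent maps
  of \<open>x' \<mapsto> (x', y)\<close> and \<open>y' \<mapsto> (x, y')\<close>. Restricting covectors along these embeddings
  evaluates the multivector fields induced by those on the factors.\<close>

definition prod_mvfield ::
  "('a, 'e::real_inner) manifold \<Rightarrow> ('b, 'f::real_inner) manifold
     \<Rightarrow> ('a, 'e) mvfield \<Rightarrow> ('b, 'f) mvfield \<Rightarrow> ('a \<times> 'b, 'e \<times> 'f) mvfield" where
  "prod_mvfield M N PM PN = (\<lambda>(x, y) \<alpha>s.
     PM x (map (pullback_covec M (prod_manifold M N) (\<lambda>x'. (x', y)) x) \<alpha>s) +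
     PN y (map (pullback_covec N (prod_manifold M N) (\<lambda>y'. (x, y')) y) \<alpha>s))"


section \<open>Coisotropic submanifolds\<close>

text \<open>Embedded submanifolds by means of slice charts. A single subspace \<open>L\<close> serves for all points;
  its dimension is the dimension of the submanifold.\<close>

definition embedded_submanifold :: "('a, 'e::real_inner) manifold \<Rightarrow> 'a set \<Rightarrow> bool" where
  "embedded_submanifold M C \<longleftrightarrow>
     C \<subseteq> points M \<and>
     (\<exists>L. subspace L \<and>
        (\<forall>x\<in>C. \<exists>\<kappa>. smooth_chart M \<kappa> \<and> x \<in> fst \<kappa> \<and>
           snd \<kappa> ` (fst \<kappa> \<inter> C) = chart_image \<kappa> \<inter> L))"

text \<open>The tangent space of a submanifold \<open>C\<close> at \<open>x\<close>, as a subset of the tangent space of \<open>M\<close>: the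
  velocities of smooth curves in \<open>C\<close> through \<open>x\<close>.\<close>

definition submanifold_tangent_space ::
  "('a, 'e::real_inner) manifold \<Rightarrow> 'a set \<Rightarrow> 'a \<Rightarrow> ('a, 'e) tvec set" where
  "submanifold_tangent_space M C x = {v \<in> tangent_space M x.
     \<exists>\<epsilon>>0. \<exists>\<gamma>. smooth_curve M \<epsilon> \<gamma> \<and> \<gamma> ` {-\<epsilon><..<\<epsilon>} \<subseteq> C \<and> \<gamma> 0 = x \<and>
       (\<forall>\<kappa>\<in>charts_at M x. ((snd \<kappa> \<circ> \<gamma>) has_vector_derivative v \<kappa>) (at 0))}"

definition annihilator ::
  "('a, 'e::real_inner) manifold \<Rightarrow> 'a set \<Rightarrow> 'a \<Rightarrow> ('a, 'e) covec set" where
  "annihilator M C x =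
     {\<alpha> \<in> cotangent_space M x. \<forall>v\<in>submanifold_tangent_space M C x. \<alpha> v = 0}"

definition coisotropic_submanifold ::
  "nat \<Rightarrow> ('a, 'e::real_inner) manifold \<Rightarrow> ('a, 'e) mvfield \<Rightarrow> 'a set \<Rightarrow> bool" where
  "coisotropic_submanifold n M P C \<longleftrightarrow>
     embedded_submanifold M C \<and>
     (\<forall>x\<in>C. \<forall>\<alpha>s. length \<alpha>s = n \<and> set \<alpha>s \<subseteq> annihilator M C x \<longrightarrow> P x \<alpha>s = 0)"

definition graph_of :: "('a, 'e) manifold \<Rightarrow> ('a \<Rightarrow> 'b) \<Rightarrow> ('a \<times> 'b) set" where
  "graph_of M \<phi> = {(m, \<phi> m) | m. m \<in> points M}"

end

theory Submission
  imports Defs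
begin

text \<open>
  Fix \<open>m\<close> in \<open>M\<close> and let \<open>D\<close> be the derivative of \<open>\<phi>\<close> at \<open>m\<close>. The tangent space of the graph at \<open>(m, \<phi> m)\<close>
  is the graph \<open>{(w, D w)}\<close> of \<open>D\<close> (\<open>submanifold_tangent_space_graph\<close>). A covector on the product is a
  pair \<open>(\<beta>, \<eta>)\<close> of covectors on the factors, and it vanishes on the graph of \<open>D\<close> iff \<open>\<beta> = - \<phi>\<^sup>*\<eta>\<close>; here
  \<open>\<eta>\<close> may be any covector at \<open>\<phi> m\<close> (\<open>annihilator_graph_restrictions\<close>,
  \<open>covector_extends_to_annihilator_graph\<close>). On \<open>n\<close> such covectors the field on the product has the value
  \<open>P\<^sub>M(-\<phi>\<^sup>*\<eta>\<^sub>1, \<dots>, -\<phi>\<^sup>*\<eta>\<^sub>n) + (-1)^(n-1) P\<^sub>N(\<eta>\<^sub>1, \<dots>, \<eta>\<^sub>n)\<close>, which is \<open>(-1)^n\<close> times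
  \<open>P\<^sub>M(\<phi>\<^sup>*\<eta>\<^sub>1, \<dots>, \<phi>\<^sup>*\<eta>\<^sub>n) - P\<^sub>N(\<eta>\<^sub>1, \<dots>, \<eta>\<^sub>n)\<close>. Hence the coisotropy condition says that this difference
  vanishes for all \<open>m\<close> and all covectors at \<open>\<phi> m\<close>.

  The bracket condition says the same for \<open>\<eta>\<^sub>i = df\<^sub>i\<close>, by the chain rule \<open>d(f \<circ> \<phi>) = \<phi>\<^sup>*df\<close>. The two agree
  because every covector is the differential of a global smooth function, constructed with a bump
  function (\<open>covector_eq_differential\<close>, \<open>multivector_map_iff_covectors\<close>).

  Finally, the graph of a smooth map is always an embedded submanifold: a shear of a product chart is
  a slice chart (\<open>embedded_submanifold_graph\<close>).

  The analysis behind this is elementary calculus in charts. Its main device is an orthonormal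
  basis of a model space, which reduces derivatives in varying directions to derivatives in finitely
  many constant ones.
\<close>

section \<open>Calculus of smooth functions\<close>

lemma Ck_on_cong:
  assumes "open S" "\<And>x. x \<in> S \<Longrightarrow> f x = g x"
  shows "Ck_on k S f \<Longrightarrow> Ck_on k S g"
  using assms(2)
proof (induction k arbitrary: f g)
  case 0
  then show ?case by (auto cong: continuous_on_cong_simp)
next
  case (Suc k)
  have d: "(g has_derivative D) (at x)" if "(f has_derivative D) (at x)" "x \<in> S" for D x
    using has_derivative_transform_within_open[OF that(1) assms(1) that(2)] Suc.prems(2) by blast
  have df: "\<And>x. x \<in> S \<Longrightarrow> f differentiable (at x)"
    using Suc.prems by simp
  have e: "frechet_derivative f (at x) = frechet_derivative g (at x)" if "x \<in> S" for x
    using d[OF _ that] df[OF that] by (metis frechet_derivative_at frechet_derivative_works)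
  have "Ck_on k S (\<lambda>x. frechet_derivative g (at x) v)" for v
    by (rule Suc.IH[of "\<lambda>x. frechet_derivative f (at x) v"]) (use Suc.prems e in auto)
  moreover have "g differentiable (at x)" if "x \<in> S" for x
    using d[OF _ that] df[OF that] by (auto simp: differentiable_def)
  ultimately show ?case by simp
qed

text \<open>The definition of \<^const>\<open>Ck_on\<close> speaks about \<^const>\<open>frechet_derivative\<close>, a choice operator. Derivatives
  at a point are unique and, on an open set, \<^const>\<open>Ck_on\<close> depends only on the values there, so any explicit
  formula for the derivative may be used instead. The closure properties under algebraic operations
  and composition are inductions over the order of differentiability through this rule.\<close>

lemma Ck_on_derivativeI:
  assumes "open S" "\<And>x. x \<in> S \<Longrightarrow> (f has_derivative f' x) (at x)"
    "\<And>v. Ck_on k S (\<lambda>x. f' x v)"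
  shows "Ck_on (Suc k) S f"
proof -
  have "Ck_on k S (\<lambda>x. frechet_derivative f (at x) v)" for v
    by (rule Ck_on_cong[OF assms(1) _ assms(3)[of v]])
       (use assms(2) frechet_derivative_at in metis)
  then show ?thesis using assms(2) by (auto simp: differentiable_def)
qed

lemma Ck_on_has_derivative:
  "Ck_on (Suc k) S f \<Longrightarrow> x \<in> S \<Longrightarrow> (f has_derivative frechet_derivative f (at x)) (at x)"
  using frechet_derivative_works by auto

lemma Ck_on_imp_continuous_on: "Ck_on k S f \<Longrightarrow> continuous_on S f"
  by (cases k) (auto intro: continuous_at_imp_continuous_on differentiable_imp_continuous_within)

lemma Ck_on_SucD: "Ck_on (Suc k) S f \<Longrightarrow> Ck_on k S f"
proof (induction k arbitrary: f)
  case 0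
  then show ?case using Ck_on_imp_continuous_on[OF 0] by simp
qed auto

lemma Ck_on_subset: "Ck_on k S f \<Longrightarrow> T \<subseteq> S \<Longrightarrow> Ck_on k T f"
  by (induction k arbitrary: f) (auto intro: continuous_on_subset)

lemma Ck_on_const: "open S \<Longrightarrow> Ck_on k S (\<lambda>x. c)"
proof (induction k arbitrary: c)
  case (Suc k)
  show ?case by (rule Ck_on_derivativeI[where f' = "\<lambda>x v. 0"]) (use Suc in auto)
qed simp

lemma Ck_on_linear_compose:
  assumes "open S" "bounded_linear L"
  shows "Ck_on k S f \<Longrightarrow> Ck_on k S (\<lambda>x. L (f x))"
proof (induction k arbitrary: f)
  case 0
  then show ?case
    using bounded_linear.continuous_on[OF assms(2)] by simp
next
  case (Suc k)
  show ?case
    by (rule Ck_on_derivativeI[where f' = "\<lambda>x v. L (frechet_derivative f (at x) v)"])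
       (use assms Suc bounded_linear.has_derivative[OF assms(2) Ck_on_has_derivative[OF Suc.prems]]
         in auto)
qed

lemma Ck_on_linear: "open S \<Longrightarrow> bounded_linear L \<Longrightarrow> Ck_on k S L"
  by (cases k) (auto intro!: Ck_on_derivativeI[where f' = "\<lambda>x. L"] Ck_on_const
      simp del: Ck_on.simps(2) simp: bounded_linear_imp_has_derivative linear_continuous_on)

lemma Ck_on_add:
  "open S \<Longrightarrow> Ck_on k S f \<Longrightarrow> Ck_on k S g \<Longrightarrow> Ck_on k S (\<lambda>x. f x + g x)"
proof (induction k arbitrary: f g)
  case (Suc k)
  show ?case
    by (rule Ck_on_derivativeI[OF \<open>open S\<close> has_derivative_add[OF
          Ck_on_has_derivative[OF Suc.prems(2)] Ck_on_has_derivative[OF Suc.prems(3)]]])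
       (use Suc in auto)
qed (auto intro: continuous_intros)

text \<open>One product rule covers inner products, real products and scalar multiples. Its summands
  contain the undifferentiated factors, which is why the induction also needs \<open>C^(k+1)\<close> to
  imply \<open>C^k\<close>.\<close>

lemma Ck_on_bilinear:
  assumes "open S" "bounded_bilinear B"
  shows "Ck_on k S f \<Longrightarrow> Ck_on k S g \<Longrightarrow> Ck_on k S (\<lambda>x. B (f x) (g x))"
proof (induction k arbitrary: f g)
  case 0
  then show ?case using bounded_bilinear.continuous_on[OF assms(2)] by auto
next
  case (Suc k)
  note D = Ck_on_has_derivative[OF Suc.prems(1)] Ck_on_has_derivative[OF Suc.prems(2)]
  have "Ck_on k S f" "Ck_on k S g"
    using Suc.prems by (auto intro: Ck_on_SucD simp del: Ck_on.simps(2))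
  moreover have "\<And>v. Ck_on k S (\<lambda>x. frechet_derivative f (at x) v)"
    "\<And>v. Ck_on k S (\<lambda>x. frechet_derivative g (at x) v)"
    using Suc.prems by auto
  ultimately show ?case
    by (intro Ck_on_derivativeI[OF assms(1) bounded_bilinear.FDERIV[OF assms(2) D]]
        Ck_on_add assms(1) Suc.IH)
qed

text \<open>A pair is the sum of the images of its components under the two linear inclusions.\<close>

lemma Ck_on_Pair:
  assumes "open S" "Ck_on k S f" "Ck_on k S g"
  shows "Ck_on k S (\<lambda>x. (f x, g x))"
proof -
  have "bounded_linear (\<lambda>a::'b. (a, 0::'c))" "bounded_linear (\<lambda>b::'c. (0::'b, b))"
    by (auto intro!: bounded_linear_Pair bounded_linear_ident bounded_linear_zero)
  from Ck_on_add[OF assms(1) Ck_on_linear_compose[OF assms(1) this(1) assms(2)]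
      Ck_on_linear_compose[OF assms(1) this(2) assms(3)]]
  show ?thesis by simp
qed

lemma Ck_on_sum:
  "open S \<Longrightarrow> (\<And>i. i \<in> I \<Longrightarrow> Ck_on k S (f i)) \<Longrightarrow> Ck_on k S (\<lambda>x. \<Sum>i\<in>I. f i x)"
  by (induction I rule: infinite_finite_induct) (auto intro: Ck_on_const Ck_on_add)

section \<open>Finite-dimensional inner product spaces\<close>

definition finite_dimensional :: "'e::real_vector itself \<Rightarrow> bool" where
  "finite_dimensional _ \<longleftrightarrow> (\<exists>B::'e set. finite B \<and> span B = UNIV)"

text \<open>Coordinates in a model space, from Gram-Schmidt: the zero vectors of an orthogonal spanning set
  are dropped and the others normalized.\<close>

lemma orthonormal_expansion:
  assumes "finite_dimensional TYPE('e::real_inner)"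
  obtains B :: "'e::real_inner set" where "finite B" "\<And>b. b \<in> B \<Longrightarrow> norm b = 1"
    "\<And>x. x = (\<Sum>b\<in>B. (x \<bullet> b) *\<^sub>R b)"
proof -
  obtain A :: "'e set" where "finite A" "span A = UNIV"
    using assms by (auto simp: finite_dimensional_def)
  then obtain C :: "'e set" where C: "finite C" "span C = UNIV" "pairwise orthogonal C"
    using basis_orthogonal by metis
  define D where "D = C - {0}"
  have D: "finite D" "span D = UNIV" "pairwise orthogonal D" "0 \<notin> D"
    using C by (auto simp: D_def pairwise_def)
  have inj: "inj_on sgn D"
  proof (rule inj_onI, rule ccontr)
    fix x y assume xy: "x \<in> D" "y \<in> D" "sgn x = sgn y" "x \<noteq> y"
    then have "x \<bullet> y = 0" using D(3) by (auto simp: pairwise_def orthogonal_def)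
    then have "sgn x \<bullet> sgn y = 0" by (simp add: sgn_div_norm)
    then have "sgn y = 0" using xy by simp
    then show False using xy D(4) by (simp add: sgn_zero_iff)
  qed
  have coef: "x = (\<Sum>b\<in>D. (x \<bullet> b / (b \<bullet> b)) *\<^sub>R b)" for x
  proof -
    have "x \<in> span D" using D by simp
    then obtain u where u: "x = (\<Sum>b\<in>D. u b *\<^sub>R b)"
      using D(1) by (auto simp: span_finite)
    have "x \<bullet> b = u b * (b \<bullet> b)" if "b \<in> D" for b
    proof -
      have "x \<bullet> b = (\<Sum>c\<in>D. u c * (c \<bullet> b))" by (simp add: u inner_sum_left)
      also have "\<dots> = (\<Sum>c\<in>D. if c = b then u b * (b \<bullet> b) else 0)"
        by (rule sum.cong) (use D(3) that in \<open>auto simp: pairwise_def orthogonal_def\<close>)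
      finally show ?thesis using D(1) that by simp
    qed
    then have "(x \<bullet> b / (b \<bullet> b)) *\<^sub>R b = u b *\<^sub>R b" if "b \<in> D" for b
      using that D(4) by auto
    then show ?thesis using u by (metis (no_types, lifting) sum.cong)
  qed
  have "x = (\<Sum>b\<in>sgn ` D. (x \<bullet> b) *\<^sub>R b)" for x
  proof -
    have "(\<Sum>b\<in>sgn ` D. (x \<bullet> b) *\<^sub>R b) = (\<Sum>b\<in>D. (x \<bullet> sgn b) *\<^sub>R sgn b)"
      using inj by (simp add: sum.reindex)
    also have "\<dots> = (\<Sum>b\<in>D. (x \<bullet> b / (b \<bullet> b)) *\<^sub>R b)"
      by (rule sum.cong)
        (auto simp: sgn_div_norm dot_square_norm power2_eq_square divide_simps)
    finally show ?thesis using coef by simp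
  qed
  moreover have "norm b = 1" if "b \<in> sgn ` D" for b
    using that D(4) by (auto simp: norm_sgn)
  ultimately show thesis using D(1) that[of "sgn ` D"] by blast
qed

lemma linear_imp_bounded_linear:
  fixes L :: "'e::real_inner \<Rightarrow> 'f::real_normed_vector"
  assumes "finite_dimensional TYPE('e)" "linear L"
  shows "bounded_linear L"
proof -
  obtain B :: "'e set" where B: "finite B" "\<And>x. x = (\<Sum>b\<in>B. (x \<bullet> b) *\<^sub>R b)"
    using orthonormal_expansion[OF assms(1)] by metis
  have "L x = (\<Sum>b\<in>B. (x \<bullet> b) *\<^sub>R L b)" for x
    by (subst B(2)[of x]) (simp add: linear_sum[OF assms(2)] linear_cmul[OF assms(2)])
  then have "L = (\<lambda>x. \<Sum>b\<in>B. (x \<bullet> b) *\<^sub>R L b)" by (rule ext)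
  moreover have "bounded_linear (\<lambda>x. \<Sum>b\<in>B. (x \<bullet> b) *\<^sub>R L b)"
    by (intro bounded_linear_sum bounded_linear_scaleR_const bounded_linear_inner_left)
  ultimately show ?thesis by (rule ssubst[of L _ bounded_linear])
qed

text \<open>Compactness of balls is used to extend functions from a chart domain by zero. The combinations
  of basis vectors with coefficients in \<open>[-r, r]\<close> form a compact set, since adding a basis vector takes
  a continuous image of a product of compact sets. The ball of radius \<open>r\<close> about \<open>0\<close> is closed in it,
  because the coefficients of \<open>x\<close> are inner products with unit vectors.\<close>

lemma compact_cball_finite_dimensional:
  fixes y :: "'e::real_inner"
  assumes "finite_dimensional TYPE('e)"
  shows "compact (cball y r)"
proof -
  obtain B :: "'e set" where B: "finite B" "\<And>b. b \<in> B \<Longrightarrow> norm b = 1"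
    "\<And>x. x = (\<Sum>b\<in>B. (x \<bullet> b) *\<^sub>R b)"
    using orthonormal_expansion[OF assms(1)] by metis
  define K where "K = (\<lambda>B::'e set. {\<Sum>b\<in>B. c b *\<^sub>R b | c. \<forall>b\<in>B. c b \<in> {-r..r}})"
  have "compact (K B)" using B(1)
  proof (induction B)
    case empty
    then show ?case by (simp add: K_def)
  next
    case (insert b B)
    have "K (insert b B) = (\<lambda>(c, x). c *\<^sub>R b + x) ` ({-r..r} \<times> K B)"
    proof (intro equalityI subsetI)
      fix x assume "x \<in> K (insert b B)"
      then obtain c where "x = (\<Sum>b\<in>insert b B. c b *\<^sub>R b)" "\<forall>b\<in>insert b B. c b \<in> {-r..r}"
        by (auto simp: K_def)
      then show "x \<in> (\<lambda>(c, x). c *\<^sub>R b + x) ` ({-r..r} \<times> K B)"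
        using insert by (auto simp: K_def intro!: image_eqI[where x="(c b, \<Sum>b\<in>B. c b *\<^sub>R b)"])
    next
      fix x assume "x \<in> (\<lambda>(c, x). c *\<^sub>R b + x) ` ({-r..r} \<times> K B)"
      then obtain d c where "x = d *\<^sub>R b + (\<Sum>b\<in>B. c b *\<^sub>R b)" "\<forall>b\<in>B. c b \<in> {-r..r}" "d \<in> {-r..r}"
        by (auto simp: K_def)
      moreover have "(\<Sum>b\<in>B. c b *\<^sub>R b) = (\<Sum>b'\<in>B. (c(b := d)) b' *\<^sub>R b')"
        by (rule sum.cong) (use insert in auto)
      ultimately show "x \<in> K (insert b B)"
        using insert by (auto simp: K_def intro!: exI[where x="c(b := d)"])
    qed
    moreover have "compact ((\<lambda>(c, x). c *\<^sub>R b + x) ` ({-r..r} \<times> K B))"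
      by (intro compact_continuous_image compact_Times insert.IH compact_Icc)
         (auto simp: case_prod_unfold intro!: continuous_intros)
    ultimately show ?case by simp
  qed
  then have "compact (cball 0 r \<inter> K B)" by (intro closed_Int_compact) auto
  moreover have "cball 0 r \<subseteq> K B"
  proof
    fix x :: 'e assume "x \<in> cball 0 r"
    then have abs: "\<bar>x \<bullet> b\<bar> \<le> r" if "b \<in> B" for b
      using Cauchy_Schwarz_ineq2[of x b] B(2)[OF that] by simp
    have "x \<bullet> b \<in> {-r..r}" if "b \<in> B" for b
      using abs[OF that] unfolding atLeastAtMost_iff by linarith
    then have "\<forall>b\<in>B. x \<bullet> b \<in> {-r..r}" by blast
    then show "x \<in> K B" unfolding K_def by (intro CollectI exI[of _ "\<lambda>b. x \<bullet> b"] conjI B(3))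
  qed
  ultimately have "compact (cball (0::'e) r)" by (simp add: Int_absorb2)
  from compact_translation[OF this, of y] show ?thesis by simp
qed

section \<open>Composition of smooth functions\<close>

text \<open>In the chain rule the direction \<open>f'(x) v\<close> in which \<open>g\<close> is differentiated varies with \<open>x\<close>, whereas
  \<^const>\<open>Ck_on\<close> controls derivatives in constant directions only. Expanding \<open>f'(x) v\<close> in an orthonormal basis
  of the space in the middle gives a finite sum of products of coefficients of \<open>f'(x) v\<close> with
  directional derivatives of \<open>g\<close> in constant directions, evaluated at \<open>f x\<close>. To these the induction
  hypothesis applies, so the middle space has to be finite-dimensional.\<close>

lemma Ck_on_compose:
  fixes f :: "'a::real_normed_vector \<Rightarrow> 'e::real_inner" and g :: "'e \<Rightarrow> 'c::real_normed_vector"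
  assumes "finite_dimensional TYPE('e)" "open S" "f ` S \<subseteq> T"
  shows "Ck_on k S f \<Longrightarrow> Ck_on k T g \<Longrightarrow> Ck_on k S (\<lambda>x. g (f x))"
proof (induction k arbitrary: g)
  case 0
  then show ?case using assms(3) by (auto intro: continuous_on_compose2)
next
  case (Suc k)
  obtain B :: "'e set" where B: "finite B" "\<And>x. x = (\<Sum>b\<in>B. (x \<bullet> b) *\<^sub>R b)"
    using orthonormal_expansion[OF assms(1)] by metis
  define f' g' where "f' = (\<lambda>x. frechet_derivative f (at x))"
    and "g' = (\<lambda>y. frechet_derivative g (at y))"
  have D: "(f has_derivative f' x) (at x)" "(g has_derivative g' (f x)) (at (f x))" if "x \<in> S" for x
    using that assms(3) Ck_on_has_derivative[OF Suc.prems(1)] Ck_on_has_derivative[OF Suc.prems(2)]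
    by (auto simp: f'_def g'_def)
  have chain: "((\<lambda>x. g (f x)) has_derivative (\<lambda>v. \<Sum>b\<in>B. (f' x v \<bullet> b) *\<^sub>R g' (f x) b)) (at x)"
    if "x \<in> S" for x
  proof -
    have lin: "linear (g' (f x))"
      using D(2)[OF that] has_derivative_linear by blast
    have expand: "g' (f x) w = (\<Sum>b\<in>B. (w \<bullet> b) *\<^sub>R g' (f x) b)" for w
      by (subst B(2)[of w]) (simp add: linear_sum[OF lin] linear_cmul[OF lin])
    have eq: "g' (f x) \<circ> f' x = (\<lambda>v. \<Sum>b\<in>B. (f' x v \<bullet> b) *\<^sub>R g' (f x) b)"
      by (rule ext) (unfold o_apply, rule expand)
    show ?thesis
      using diff_chain_at[OF D(1)[OF that] D(2)[OF that]] unfolding eq by (simp only: o_def)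
  qed
  show ?case
  proof (rule Ck_on_derivativeI[OF assms(2) chain])
    fix v
    have "Ck_on k S f" using Suc.prems(1) by (rule Ck_on_SucD)
    moreover have "Ck_on k S (\<lambda>x. f' x v)" "\<And>b. Ck_on k T (\<lambda>y. g' y b)"
      using Suc.prems by (auto simp: f'_def g'_def)
    ultimately show "Ck_on k S (\<lambda>x. \<Sum>b\<in>B. (f' x v \<bullet> b) *\<^sub>R g' (f x) b)"
      by (intro Ck_on_sum Ck_on_bilinear[OF _ bounded_bilinear_scaleR] assms(2)
          Ck_on_linear_compose[OF _ bounded_linear_inner_left] Suc.IH)
  qed
qed

lemma smooth_on_cong:
  "smooth_on S f \<Longrightarrow> open S \<Longrightarrow> (\<And>x. x \<in> S \<Longrightarrow> f x = g x) \<Longrightarrow> smooth_on S g"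
  unfolding smooth_on_def using Ck_on_cong by blast

lemma smooth_on_subset: "smooth_on S f \<Longrightarrow> T \<subseteq> S \<Longrightarrow> smooth_on T f"
  unfolding smooth_on_def using Ck_on_subset by blast

lemma smooth_on_locally:
  assumes "\<And>x. x \<in> S \<Longrightarrow> \<exists>T. open T \<and> x \<in> T \<and> smooth_on T f"
  shows "smooth_on S f"
proof -
  have "Ck_on k S f" if "\<And>x. x \<in> S \<Longrightarrow> \<exists>T. open T \<and> x \<in> T \<and> Ck_on k T f" for k
    using that
  proof (induction k arbitrary: f)
    case 0
    then have "continuous (at x) f" if "x \<in> S" for x
      using that by (metis Ck_on.simps(1) continuous_on_eq_continuous_at)
    then show ?case by (simp add: continuous_at_imp_continuous_on)
  next
    case (Suc k)
    have "Ck_on k S (\<lambda>x. frechet_derivative f (at x) v)" for v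
      by (rule Suc.IH) (use Suc.prems in \<open>metis Ck_on.simps(2)\<close>)
    moreover have "f differentiable (at x)" if "x \<in> S" for x
      using Suc.prems[OF that] by auto
    ultimately show ?case by simp
  qed
  then show ?thesis using assms unfolding smooth_on_def by metis
qed

lemma smooth_on_compose:
  fixes f :: "'a::real_normed_vector \<Rightarrow> 'e::real_inner" and g :: "'e \<Rightarrow> 'c::real_normed_vector"
  assumes "finite_dimensional TYPE('e)" "open S" "smooth_on S f" "smooth_on T g"
    "\<And>x. x \<in> S \<Longrightarrow> f x \<in> T"
  shows "smooth_on S (\<lambda>x. g (f x))"
  using assms(3-) Ck_on_compose[OF assms(1,2), of f T] unfolding smooth_on_def by blast

lemma smooth_on_const: "open S \<Longrightarrow> smooth_on S (\<lambda>x. c)"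
  by (simp add: smooth_on_def Ck_on_const)

lemma smooth_on_linear: "open S \<Longrightarrow> bounded_linear L \<Longrightarrow> smooth_on S L"
  by (simp add: smooth_on_def Ck_on_linear)

lemma smooth_on_add:
  "open S \<Longrightarrow> smooth_on S f \<Longrightarrow> smooth_on S g \<Longrightarrow> smooth_on S (\<lambda>x. f x + g x)"
  by (simp add: smooth_on_def Ck_on_add)

lemma smooth_on_bilinear:
  "open S \<Longrightarrow> bounded_bilinear B \<Longrightarrow> smooth_on S f \<Longrightarrow> smooth_on S g
    \<Longrightarrow> smooth_on S (\<lambda>x. B (f x) (g x))"
  by (simp add: smooth_on_def Ck_on_bilinear)

lemma smooth_on_linear_compose:
  "open S \<Longrightarrow> bounded_linear L \<Longrightarrow> smooth_on S f \<Longrightarrow> smooth_on S (\<lambda>x. L (f x))"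
  by (simp add: smooth_on_def Ck_on_linear_compose)

lemma smooth_on_diff:
  assumes "open S" "smooth_on S f" "smooth_on S g"
  shows "smooth_on S (\<lambda>x. f x - g x)"
  using smooth_on_add[OF assms(1,2) smooth_on_linear_compose[OF assms(1)
        bounded_linear_minus[OF bounded_linear_ident] assms(3)]] by simp

lemma smooth_on_Pair:
  "open S \<Longrightarrow> smooth_on S f \<Longrightarrow> smooth_on S g \<Longrightarrow> smooth_on S (\<lambda>x. (f x, g x))"
  by (simp add: smooth_on_def Ck_on_Pair)

lemma smooth_on_imp_continuous_on: "smooth_on S f \<Longrightarrow> continuous_on S f"
  unfolding smooth_on_def using Ck_on_imp_continuous_on by blast

lemma smooth_on_has_derivative:
  "smooth_on S f \<Longrightarrow> x \<in> S \<Longrightarrow> (f has_derivative frechet_derivative f (at x)) (at x)"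
  unfolding smooth_on_def using Ck_on_has_derivative by blast

section \<open>Bump functions\<close>

text \<open>For \<open>n = 0\<close> this is the classical smooth function that vanishes to infinite order at \<open>0\<close>. The powers
  of \<open>1/t\<close> are included so that the family is closed under differentiation up to linear
  combinations, which makes smoothness of all members a single induction.\<close>

definition flat :: "nat \<Rightarrow> real \<Rightarrow> real" where
  "flat n t = (if t > 0 then exp (- inverse t) * inverse t ^ n else 0)"

lemma flat_tendsto_0: "((\<lambda>t. flat n t) \<longlongrightarrow> 0) (at 0)"
proof -
  \<comment> \<open>Put \<open>s = 1/t\<close> and use that the exponential outgrows all powers.\<close>
  have "((\<lambda>s::real. s ^ n / exp s) \<longlongrightarrow> 0) at_top" by (rule tendsto_power_div_exp_0)
  then have "((\<lambda>t::real. inverse t ^ n / exp (inverse t)) \<longlongrightarrow> 0) (at_right 0)"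
    by (rule filterlim_compose[OF _ filterlim_inverse_at_top_right])
  then have "((\<lambda>t. flat n t) \<longlongrightarrow> 0) (at_right 0)"
    by (rule Lim_transform_eventually)
      (auto simp: flat_def eventually_at_right_less exp_minus field_simps
        intro!: eventually_mono[OF eventually_at_right_less])
  moreover have "((\<lambda>t. flat n t) \<longlongrightarrow> 0) (at_left 0)"
    by (rule tendsto_eventually) (auto simp: flat_def eventually_at_filter)
  ultimately show ?thesis by (simp add: filterlim_split_at)
qed

lemma flat_has_derivative:
  "(flat n has_real_derivative (flat (n + 2) t - n * flat (n + 1) t)) (at t)"
proof -
  consider "t > 0" | "t = 0" | "t < 0" by linarith
  then show ?thesis
  proof cases
    case 1
    have "((\<lambda>t. exp (- inverse t) * inverse t ^ n) has_real_derivative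
        (flat (n + 2) t - n * flat (n + 1) t)) (at t)"
      using 1 by (auto intro!: derivative_eq_intros simp: flat_def power2_eq_square)
         (cases n; simp add: field_simps)
    then show ?thesis
      by (rule has_field_derivative_transform_within_open[where S="{0<..}"])
        (use 1 in \<open>auto simp: flat_def\<close>)
  next
    case 2
    \<comment> \<open>The difference quotient of \<open>flat n\<close> at \<open>0\<close> is \<open>flat (n + 1)\<close>.\<close>
    have "((\<lambda>h. (flat n (0 + h) - flat n 0) / h) \<longlongrightarrow> 0) (at 0)"
      using flat_tendsto_0[of "n + 1"]
      by (rule Lim_transform_eventually) (auto simp: flat_def field_simps)
    then show ?thesis using 2 by (simp add: DERIV_def flat_def)
  next
    case 3
    have "((\<lambda>t. 0) has_real_derivative 0) (at t)" by simp
    then have "(flat n has_real_derivative 0) (at t)"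
      by (rule has_field_derivative_transform_within_open[where S="{..<0}"])
        (use 3 in \<open>auto simp: flat_def\<close>)
    then show ?thesis using 3 by (simp add: flat_def)
  qed
qed

lemma Ck_on_flat: "Ck_on k UNIV (flat n)"
proof (induction k arbitrary: n)
  case 0
  then show ?case
    using DERIV_isCont[OF flat_has_derivative] by (auto simp: continuous_on_eq_continuous_at)
next
  case (Suc k)
  show ?case
  proof (rule Ck_on_derivativeI[OF open_UNIV])
    show "(flat n has_derivative (\<lambda>v. (flat (n + 2) t - n * flat (n + 1) t) * v)) (at t)" for t
      using flat_has_derivative[of n t] by (simp add: has_field_derivative_def)
    have "Ck_on k UNIV (\<lambda>t. v *\<^sub>R flat (n + 2) t + (- n * v) *\<^sub>R flat (n + 1) t)" for v :: real
      by (intro Ck_on_add Ck_on_linear_compose[OF _ bounded_linear_scaleR_right] open_UNIV Suc)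
    then show "Ck_on k UNIV (\<lambda>t. (flat (n + 2) t - n * flat (n + 1) t) * v)" for v
      by (simp add: algebra_simps)
  qed
qed

text \<open>The function is \<open>x \<mapsto> L (x - y)\<close> times a cutoff with value \<open>1\<close> at \<open>y\<close> and \<open>0\<close> outside the ball. As the linear
  factor vanishes at \<open>y\<close>, the product rule leaves exactly \<open>L\<close>.\<close>

lemma bump_function:
  fixes L :: "'e::real_inner \<Rightarrow> real"
  assumes "bounded_linear L" "r > 0"
  obtains g where "smooth_on UNIV g" "\<And>x. x \<notin> cball y r \<Longrightarrow> g x = 0" "(g has_derivative L) (at y)"
proof -
  define \<beta> where "\<beta> = (\<lambda>x. flat 0 (r\<^sup>2 - (x - y) \<bullet> (x - y)))"
  define g where "g = (\<lambda>x. L (x - y) * (\<beta> x / \<beta> y))"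
  have fd: "finite_dimensional TYPE(real)"
    unfolding finite_dimensional_def
    by (rule exI[of _ "{1}"]) (auto simp: span_singleton intro: exI[where x="x" for x])
  have lin: "smooth_on UNIV (\<lambda>x. x - y)"
    by (intro smooth_on_diff smooth_on_const smooth_on_linear bounded_linear_ident open_UNIV)
  have "smooth_on UNIV (\<lambda>x. r\<^sup>2 - (x - y) \<bullet> (x - y))"
    by (intro smooth_on_diff smooth_on_const smooth_on_bilinear[OF _ bounded_bilinear_inner]
        lin open_UNIV)
  from smooth_on_compose[OF fd open_UNIV this, of UNIV "flat 0"]
  have \<beta>: "smooth_on UNIV \<beta>"
    by (simp add: \<beta>_def smooth_on_def Ck_on_flat)
  have pos: "\<beta> y > 0" using assms(2) by (simp add: \<beta>_def flat_def)
  have "smooth_on UNIV g"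
    unfolding g_def
    by (intro smooth_on_bilinear[OF _ bounded_bilinear_mult] smooth_on_linear_compose[OF _ assms(1)]
        smooth_on_linear_compose[OF _ bounded_linear_divide] lin \<beta> open_UNIV)
  moreover have "g x = 0" if "x \<notin> cball y r" for x
  proof -
    have "r\<^sup>2 \<le> (norm (x - y))\<^sup>2"
      using that assms(2) by (intro power_mono) (auto simp: dist_norm norm_minus_commute)
    then show ?thesis by (simp add: g_def \<beta>_def flat_def dot_square_norm)
  qed
  moreover have "(g has_derivative L) (at y)"
  proof -
    have "((\<lambda>x. L (x - y)) has_derivative (\<lambda>v. L (v - 0))) (at y)"
      by (rule bounded_linear.has_derivative[OF assms(1)]) (auto intro!: derivative_eq_intros)
    then have "((\<lambda>x. L (x - y)) has_derivative L) (at y)" by simp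
    moreover have "((\<lambda>x. \<beta> x / \<beta> y) has_derivative frechet_derivative (\<lambda>x. \<beta> x / \<beta> y) (at y)) (at y)"
      by (intro smooth_on_has_derivative[of UNIV]
          smooth_on_linear_compose[OF _ bounded_linear_divide] \<beta>) auto
    ultimately show ?thesis
      unfolding g_def using has_derivative_mult pos linear_0[OF bounded_linear.linear[OF assms(1)]]
      by fastforce
  qed
  ultimately show thesis using that by blast
qed

section \<open>Charts and tangent coordinates\<close>

lemma chart_openin: "is_chart X \<kappa> \<Longrightarrow> openin X (fst \<kappa>)"
  and open_chart_image: "is_chart X \<kappa> \<Longrightarrow> open (chart_image \<kappa>)"
  by (auto simp: is_chart_def)

lemma chart_subset: "is_chart X \<kappa> \<Longrightarrow> fst \<kappa> \<subseteq> topspace X"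
  using chart_openin openin_subset by blast

lemma chart_inj: "is_chart X \<kappa> \<Longrightarrow> inj_on (snd \<kappa>) (fst \<kappa>)"
  using homeomorphic_imp_injective_map[of "subtopology X (fst \<kappa>)" _ "snd \<kappa>"] chart_subset[of X \<kappa>]
  by (auto simp: is_chart_def Int_absorb1)

lemma chart_inv_chart: "is_chart X \<kappa> \<Longrightarrow> p \<in> fst \<kappa> \<Longrightarrow> chart_inv \<kappa> (snd \<kappa> p) = p"
  by (rule inv_into_f_f[OF chart_inj])

lemma chart_inv_in: "e \<in> chart_image \<kappa> \<Longrightarrow> chart_inv \<kappa> e \<in> fst \<kappa>"
  and chart_chart_inv: "e \<in> chart_image \<kappa> \<Longrightarrow> snd \<kappa> (chart_inv \<kappa> e) = e"
  by (auto intro: inv_into_into f_inv_into_f)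

lemma continuous_map_chart:
  "is_chart X \<kappa> \<Longrightarrow> continuous_map (subtopology X (fst \<kappa>)) (top_of_set (chart_image \<kappa>)) (snd \<kappa>)"
  by (simp add: is_chart_def homeomorphic_imp_continuous_map)

lemma continuous_map_chart_inv:
  assumes "is_chart X \<kappa>"
  shows "continuous_map (top_of_set (chart_image \<kappa>)) (subtopology X (fst \<kappa>)) (chart_inv \<kappa>)"
proof -
  have "open_map (subtopology X (fst \<kappa>)) (top_of_set (chart_image \<kappa>)) (snd \<kappa>)"
    using assms by (simp add: is_chart_def homeomorphic_imp_open_map)
  then show ?thesis
    by (subst open_eq_continuous_inverse_map[symmetric, where f="snd \<kappa>"])
       (use chart_subset[OF assms] in \<open>auto simp: chart_inv_chart[OF assms]\<close>)
qed

lemma open_image_chart: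
  assumes "is_chart X \<kappa>" "openin X W" "W \<subseteq> fst \<kappa>"
  shows "open (snd \<kappa> ` W)"
proof -
  have "open_map (subtopology X (fst \<kappa>)) (top_of_set (chart_image \<kappa>)) (snd \<kappa>)"
    using assms(1) by (simp add: is_chart_def homeomorphic_imp_open_map)
  moreover have "openin (subtopology X (fst \<kappa>)) W"
    using assms by (simp add: openin_open_subtopology chart_openin)
  ultimately have "openin (top_of_set (chart_image \<kappa>)) (snd \<kappa> ` W)"
    by (simp add: open_map_def)
  then show ?thesis
    using openin_open_trans[OF _ open_chart_image[OF assms(1)]] by blast
qed

text \<open>The part of the definition of a manifold on which calculus in charts rests. It is separated from
  the conditions on the topology so that it can be established for products chart by chart.\<close>

definition smooth_atlas :: "('a, 'e::real_inner) manifold \<Rightarrow> bool" where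
  "smooth_atlas M \<longleftrightarrow> finite_dimensional TYPE('e) \<and>
     (\<forall>\<kappa>\<in>atlas M. is_chart (mtop M) \<kappa>) \<and> (\<Union>\<kappa>\<in>atlas M. fst \<kappa>) = points M \<and>
     (\<forall>\<kappa>\<in>atlas M. \<forall>\<kappa>'\<in>atlas M. compatible \<kappa> \<kappa>')"

lemma smooth_manifold_imp_smooth_atlas: "smooth_manifold M \<Longrightarrow> smooth_atlas M"
  by (simp add: smooth_manifold_def smooth_atlas_def finite_dimensional_def)

lemma smooth_atlas_finite_dimensional:
    "smooth_atlas (M :: ('a, 'e::real_inner) manifold) \<Longrightarrow> finite_dimensional TYPE('e)"
  and smooth_atlas_is_chart: "smooth_atlas M \<Longrightarrow> \<kappa> \<in> atlas M \<Longrightarrow> is_chart (mtop M) \<kappa>"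
  and smooth_atlas_compatible:
    "smooth_atlas M \<Longrightarrow> \<kappa> \<in> atlas M \<Longrightarrow> \<kappa>' \<in> atlas M \<Longrightarrow> compatible \<kappa> \<kappa>'"
  by (auto simp: smooth_atlas_def)

lemma charts_atD: "\<kappa> \<in> charts_at M p \<Longrightarrow> \<kappa> \<in> atlas M" "\<kappa> \<in> charts_at M p \<Longrightarrow> p \<in> fst \<kappa>"
  by (auto simp: charts_at_def)

lemma chart_at_in_charts_at: "smooth_atlas M \<Longrightarrow> p \<in> points M \<Longrightarrow> chart_at M p \<in> charts_at M p"
  unfolding chart_at_def smooth_atlas_def charts_at_def by (rule someI_ex) blast

lemma charts_at_is_chart: "smooth_atlas M \<Longrightarrow> \<kappa> \<in> charts_at M p \<Longrightarrow> is_chart (mtop M) \<kappa>"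
  by (rule smooth_atlas_is_chart[OF _ charts_atD(1)])

lemma open_chart_overlap:
  assumes "smooth_atlas M" "\<kappa> \<in> atlas M" "\<kappa>' \<in> atlas M"
  shows "open (snd \<kappa> ` (fst \<kappa> \<inter> fst \<kappa>'))"
  using assms by (intro open_image_chart[of "mtop M"] openin_Int)
    (auto simp: smooth_atlas_is_chart chart_openin)

definition transition :: "('a, 'e::real_inner) chart \<Rightarrow> ('a, 'e) chart \<Rightarrow> 'a \<Rightarrow> 'e \<Rightarrow> 'e" where
  "transition \<kappa> \<kappa>' p = frechet_derivative (snd \<kappa>' \<circ> chart_inv \<kappa>) (at (snd \<kappa> p))"

lemma transition_has_derivative:
  assumes "smooth_atlas M" "\<kappa> \<in> charts_at M p" "\<kappa>' \<in> charts_at M p"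
  shows "((snd \<kappa>' \<circ> chart_inv \<kappa>) has_derivative transition \<kappa> \<kappa>' p) (at (snd \<kappa> p))"
  unfolding transition_def
proof (rule smooth_on_has_derivative)
  show "smooth_on (snd \<kappa> ` (fst \<kappa> \<inter> fst \<kappa>')) (snd \<kappa>' \<circ> chart_inv \<kappa>)"
    using smooth_atlas_compatible[OF assms(1) charts_atD(1)[OF assms(2)] charts_atD(1)[OF assms(3)]]
    by (simp add: compatible_def)
qed (intro imageI IntI charts_atD(2)[OF assms(2)] charts_atD(2)[OF assms(3)])

text \<open>Near the point the two coordinate expressions of \<open>F\<close> differ by a transition map, so the chain
  rule applies. The next lemma does the same for the
  chart in the target, where \<open>f\<close> has to stay in the chart domain near the point; it serves both for
  curves and for coordinate expressions of maps.\<close>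

lemma derivative_change_source_chart:
  assumes "smooth_atlas M" "\<kappa> \<in> charts_at M p" "\<kappa>' \<in> charts_at M p"
    "((F \<circ> chart_inv \<kappa>) has_derivative A) (at (snd \<kappa> p))"
  shows "((F \<circ> chart_inv \<kappa>') has_derivative (A \<circ> transition \<kappa>' \<kappa> p)) (at (snd \<kappa>' p))"
proof -
  note ch = charts_at_is_chart[OF assms(1,2)] charts_at_is_chart[OF assms(1,3)]
  have p: "(snd \<kappa> \<circ> chart_inv \<kappa>') (snd \<kappa>' p) = snd \<kappa> p"
    by (simp add: chart_inv_chart[OF ch(2) charts_atD(2)[OF assms(3)]])
  have "((F \<circ> chart_inv \<kappa>) \<circ> (snd \<kappa> \<circ> chart_inv \<kappa>') has_derivative (A \<circ> transition \<kappa>' \<kappa> p))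
      (at (snd \<kappa>' p))"
    by (rule diff_chain_at[OF transition_has_derivative[OF assms(1,3,2)]]) (simp only: p assms(4))
  then show ?thesis
  proof (rule has_derivative_transform_within_open)
    show "open (snd \<kappa>' ` (fst \<kappa>' \<inter> fst \<kappa>))"
      by (intro open_chart_overlap[OF assms(1)] charts_atD(1)[OF assms(3)] charts_atD(1)[OF assms(2)])
    show "snd \<kappa>' p \<in> snd \<kappa>' ` (fst \<kappa>' \<inter> fst \<kappa>)"
      by (intro imageI IntI charts_atD(2)[OF assms(2)] charts_atD(2)[OF assms(3)])
    show "((F \<circ> chart_inv \<kappa>) \<circ> (snd \<kappa> \<circ> chart_inv \<kappa>')) x = (F \<circ> chart_inv \<kappa>') x"
      if "x \<in> snd \<kappa>' ` (fst \<kappa>' \<inter> fst \<kappa>)" for x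
      using that by (auto simp: chart_inv_chart[OF ch(1)] chart_inv_chart[OF ch(2)])
  qed
qed

lemma derivative_change_target_chart:
  assumes "smooth_atlas M" "\<kappa> \<in> charts_at M (f x)" "\<kappa>' \<in> charts_at M (f x)"
    "open S" "x \<in> S" "\<And>y. y \<in> S \<Longrightarrow> f y \<in> fst \<kappa>"
    "((snd \<kappa> \<circ> f) has_derivative A) (at x)"
  shows "((snd \<kappa>' \<circ> f) has_derivative (transition \<kappa> \<kappa>' (f x) \<circ> A)) (at x)"
proof -
  note ch = charts_at_is_chart[OF assms(1,2)]
  have "((snd \<kappa>' \<circ> chart_inv \<kappa>) \<circ> (snd \<kappa> \<circ> f) has_derivative (transition \<kappa> \<kappa>' (f x) \<circ> A)) (at x)"
    by (rule diff_chain_at[OF assms(7)]) (simp add: transition_has_derivative[OF assms(1-3)])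
  then show ?thesis
    by (rule has_derivative_transform_within_open[OF _ assms(4,5)])
      (use assms(6) in \<open>simp add: chart_inv_chart[OF ch]\<close>)
qed

lemma transition_self:
  assumes "smooth_atlas M" "\<kappa> \<in> charts_at M p"
  shows "transition \<kappa> \<kappa> p = id"
proof -
  note ch = charts_at_is_chart[OF assms]
  have "(id has_derivative id) (at (snd \<kappa> p))" by (simp add: id_def)
  then have "((snd \<kappa> \<circ> chart_inv \<kappa>) has_derivative id) (at (snd \<kappa> p))"
    by (rule has_derivative_transform_within_open[OF _ open_chart_image[OF ch]])
      (use charts_atD[OF assms(2)] in \<open>auto simp: chart_inv_chart[OF ch]\<close>)
  then show ?thesis
    using has_derivative_unique transition_has_derivative[OF assms(1,2,2)] by blast
qed

lemma transition_transition:
  assumes "smooth_atlas M" "\<kappa> \<in> charts_at M p" "\<kappa>' \<in> charts_at M p" "\<kappa>'' \<in> charts_at M p"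
  shows "transition \<kappa> \<kappa>'' p (transition \<kappa>' \<kappa> p e) = transition \<kappa>' \<kappa>'' p e"
proof -
  have "transition \<kappa> \<kappa>'' p \<circ> transition \<kappa>' \<kappa> p = transition \<kappa>' \<kappa>'' p"
    by (rule has_derivative_unique[OF derivative_change_source_chart[OF assms(1-3)
          transition_has_derivative[OF assms(1,2,4)]] transition_has_derivative[OF assms(1,3,4)]])
  from fun_cong[OF this, of e] show ?thesis by simp
qed

lemma linear_transition:
  "smooth_atlas M \<Longrightarrow> \<kappa> \<in> charts_at M p \<Longrightarrow> \<kappa>' \<in> charts_at M p \<Longrightarrow> linear (transition \<kappa> \<kappa>' p)"
  by (rule has_derivative_linear[OF transition_has_derivative])

text \<open>The tangent vector with coordinates \<open>e\<close> in the chart \<open>\<kappa>\<close>. This is the inverse of \<open>v \<mapsto> v \<kappa>\<close>, which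
  identifies the tangent space with the model space, as the lemmas
  \<open>tangent_vector_same_chart\<close> and \<open>tangent_vector_of_coordinates\<close> show.\<close>

definition tangent_vector ::
  "('a, 'e::real_inner) manifold \<Rightarrow> 'a \<Rightarrow> ('a, 'e) chart \<Rightarrow> 'e \<Rightarrow> ('a, 'e) tvec" where
  "tangent_vector M p \<kappa> e = (\<lambda>\<kappa>'. if \<kappa>' \<in> charts_at M p then transition \<kappa> \<kappa>' p e else 0)"

lemma tangent_space_iff:
  "v \<in> tangent_space M p \<longleftrightarrow> (\<forall>\<kappa>. \<kappa> \<notin> charts_at M p \<longrightarrow> v \<kappa> = 0) \<and>
     (\<forall>\<kappa>\<in>charts_at M p. \<forall>\<kappa>'\<in>charts_at M p. v \<kappa>' = transition \<kappa> \<kappa>' p (v \<kappa>))"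
  by (simp add: tangent_space_def transition_def)

lemma tangent_vector_in_tangent_space:
  "smooth_atlas M \<Longrightarrow> \<kappa> \<in> charts_at M p \<Longrightarrow> tangent_vector M p \<kappa> e \<in> tangent_space M p"
  unfolding tangent_space_iff tangent_vector_def by (simp add: transition_transition)

lemma tangent_vector_same_chart:
  "smooth_atlas M \<Longrightarrow> \<kappa> \<in> charts_at M p \<Longrightarrow> tangent_vector M p \<kappa> e \<kappa> = e"
  by (simp add: tangent_vector_def transition_self)

lemma tangent_vector_of_coordinates:
  assumes "v \<in> tangent_space M p" "\<kappa> \<in> charts_at M p"
  shows "tangent_vector M p \<kappa> (v \<kappa>) = v"
proof
  show "tangent_vector M p \<kappa> (v \<kappa>) \<kappa>' = v \<kappa>'" for \<kappa>'
    using assms unfolding tangent_space_iff tangent_vector_def by metis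
qed

lemma tangent_vector_linear_combination:
  assumes "smooth_atlas M" "\<kappa> \<in> charts_at M p"
  shows "tangent_vector M p \<kappa> (a *\<^sub>R x + b *\<^sub>R y) =
    (\<lambda>\<kappa>'. a *\<^sub>R tangent_vector M p \<kappa> x \<kappa>' + b *\<^sub>R tangent_vector M p \<kappa> y \<kappa>')"
  by (rule ext)
    (simp add: tangent_vector_def linear_add[OF linear_transition[OF assms]]
      linear_cmul[OF linear_transition[OF assms]])

lemma tangent_space_linear_combination:
  assumes "smooth_atlas M" "v \<in> tangent_space M p" "w \<in> tangent_space M p"
  shows "(\<lambda>\<kappa>. a *\<^sub>R v \<kappa> + b *\<^sub>R w \<kappa>) \<in> tangent_space M p"
proof (cases "charts_at M p = {}")
  case True
  then show ?thesis using assms by (simp add: tangent_space_iff)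
next
  case False
  then obtain \<kappa> where \<kappa>: "\<kappa> \<in> charts_at M p" by blast
  have "tangent_vector M p \<kappa> (a *\<^sub>R v \<kappa> + b *\<^sub>R w \<kappa>) = (\<lambda>\<kappa>. a *\<^sub>R v \<kappa> + b *\<^sub>R w \<kappa>)"
    unfolding tangent_vector_linear_combination[OF assms(1) \<kappa>]
    by (simp only: tangent_vector_of_coordinates[OF assms(2) \<kappa>] tangent_vector_of_coordinates[OF assms(3) \<kappa>])
  then show ?thesis
    using tangent_vector_in_tangent_space[OF assms(1) \<kappa>, of "a *\<^sub>R v \<kappa> + b *\<^sub>R w \<kappa>"] by simp
qed

text \<open>Through a chart, covectors become linear functionals on the model space, so that all questions
  about covectors turn into linear algebra.\<close>

definition coord_covec ::
  "('a, 'e::real_inner) manifold \<Rightarrow> 'a \<Rightarrow> ('a, 'e) chart \<Rightarrow> ('e \<Rightarrow> real) \<Rightarrow> ('a, 'e) covec" where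
  "coord_covec M p \<kappa> A = (\<lambda>v. if v \<in> tangent_space M p then A (v \<kappa>) else 0)"

lemma coord_covec_in_cotangent_space:
  assumes "smooth_atlas M" "linear A"
  shows "coord_covec M p \<kappa> A \<in> cotangent_space M p"
  unfolding cotangent_space_def coord_covec_def
  by (simp add: tangent_space_linear_combination[OF assms(1)] linear_add[OF assms(2)] linear_cmul[OF assms(2)])

lemma cotangent_space_eq_coord_covec:
  assumes "smooth_atlas M" "\<kappa> \<in> charts_at M p" "\<alpha> \<in> cotangent_space M p"
  obtains A where "linear A" "\<alpha> = coord_covec M p \<kappa> A"
proof
  define A where "A = (\<lambda>e. \<alpha> (tangent_vector M p \<kappa> e))"
  have comb: "A (a *\<^sub>R x + b *\<^sub>R y) = a * A x + b * A y" for a b x y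
    using assms(3) tangent_vector_in_tangent_space[OF assms(1,2)]
    by (simp add: A_def tangent_vector_linear_combination[OF assms(1,2)] cotangent_space_def)
  show "linear A"
  proof (rule linearI)
    show "A (x + y) = A x + A y" for x y using comb[of 1 x 1 y] by simp
    show "A (a *\<^sub>R x) = a *\<^sub>R A x" for a x using comb[of a x 0 0] by simp
  qed
  show "\<alpha> = coord_covec M p \<kappa> A"
  proof
    fix v
    show "\<alpha> v = coord_covec M p \<kappa> A v"
    proof (cases "v \<in> tangent_space M p")
      case True
      then show ?thesis
        by (simp only: A_def coord_covec_def if_True tangent_vector_of_coordinates[OF True assms(2)])
    qed (use assms(3) in \<open>simp add: coord_covec_def cotangent_space_def\<close>)
  qed
qed

section \<open>Tangent maps in charts\<close>

lemma smooth_map_in_points: "smooth_map M N \<phi> \<Longrightarrow> p \<in> points M \<Longrightarrow> \<phi> p \<in> points N"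
  by (auto simp: smooth_map_def continuous_map_def)

lemma smooth_map_openin:
  assumes "smooth_atlas M" "smooth_atlas N" "smooth_map M N \<phi>" "\<kappa> \<in> atlas M" "\<kappa>' \<in> atlas N"
  shows "openin (mtop M) {p \<in> fst \<kappa>. \<phi> p \<in> fst \<kappa>'}"
proof -
  note ch = smooth_atlas_is_chart[OF assms(1,4)] smooth_atlas_is_chart[OF assms(2,5)]
  have "continuous_map (mtop M) (mtop N) \<phi>"
    using assms(3) by (simp add: smooth_map_def)
  then have "openin (mtop M) {p \<in> points M. \<phi> p \<in> fst \<kappa>'}"
    using chart_openin[OF ch(2)] by (rule openin_continuous_map_preimage)
  moreover have "{p \<in> fst \<kappa>. \<phi> p \<in> fst \<kappa>'} = fst \<kappa> \<inter> {p \<in> points M. \<phi> p \<in> fst \<kappa>'}"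
    using chart_subset[OF ch(1)] by auto
  ultimately show ?thesis using chart_openin[OF ch(1)] by auto
qed

lemma smooth_map_open:
  assumes "smooth_atlas M" "smooth_atlas N" "smooth_map M N \<phi>" "\<kappa> \<in> atlas M" "\<kappa>' \<in> atlas N"
  shows "open (snd \<kappa> ` {p \<in> fst \<kappa>. \<phi> p \<in> fst \<kappa>'})"
  by (rule open_image_chart[OF smooth_atlas_is_chart[OF assms(1,4)] smooth_map_openin[OF assms]]) auto

definition local_derivative ::
  "('a, 'e::real_inner) chart \<Rightarrow> ('b, 'f::real_inner) chart \<Rightarrow> ('a \<Rightarrow> 'b) \<Rightarrow> 'a \<Rightarrow> 'e \<Rightarrow> 'f" where
  "local_derivative \<kappa> \<kappa>' \<phi> p = frechet_derivative (snd \<kappa>' \<circ> \<phi> \<circ> chart_inv \<kappa>) (at (snd \<kappa> p))"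

lemma local_derivative_has_derivative:
  assumes "smooth_map M N \<phi>" "\<kappa> \<in> charts_at M p" "\<kappa>' \<in> charts_at N (\<phi> p)"
  shows "((snd \<kappa>' \<circ> \<phi> \<circ> chart_inv \<kappa>) has_derivative local_derivative \<kappa> \<kappa>' \<phi> p) (at (snd \<kappa> p))"
  unfolding local_derivative_def
proof (rule smooth_on_has_derivative[of "snd \<kappa> ` {p \<in> fst \<kappa>. \<phi> p \<in> fst \<kappa>'}"])
  show "smooth_on (snd \<kappa> ` {p \<in> fst \<kappa>. \<phi> p \<in> fst \<kappa>'}) (snd \<kappa>' \<circ> \<phi> \<circ> chart_inv \<kappa>)"
    using assms(1) charts_atD(1)[OF assms(2)] charts_atD(1)[OF assms(3)]
    unfolding smooth_map_def by blast
qed (use charts_atD(2)[OF assms(2)] charts_atD(2)[OF assms(3)] in blast)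

text \<open>This compatibility with transition maps is what makes the coordinates of an image under the
  tangent map those of a tangent vector.\<close>

lemma local_derivative_change_target:
  assumes "smooth_atlas M" "smooth_atlas N" "smooth_map M N \<phi>" "\<kappa> \<in> charts_at M p"
    "\<kappa>' \<in> charts_at N (\<phi> p)" "\<kappa>'' \<in> charts_at N (\<phi> p)"
  shows "local_derivative \<kappa> \<kappa>'' \<phi> p = transition \<kappa>' \<kappa>'' (\<phi> p) \<circ> local_derivative \<kappa> \<kappa>' \<phi> p"
proof -
  note ch = charts_at_is_chart[OF assms(1,4)]
  have p: "(\<phi> \<circ> chart_inv \<kappa>) (snd \<kappa> p) = \<phi> p"
    using chart_inv_chart[OF ch charts_atD(2)[OF assms(4)]] by simp
  have D: "((snd \<kappa>'' \<circ> (\<phi> \<circ> chart_inv \<kappa>)) has_derivative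
      (transition \<kappa>' \<kappa>'' ((\<phi> \<circ> chart_inv \<kappa>) (snd \<kappa> p)) \<circ> local_derivative \<kappa> \<kappa>' \<phi> p)) (at (snd \<kappa> p))"
  proof (rule derivative_change_target_chart[OF assms(2)])
    show "open (snd \<kappa> ` {p \<in> fst \<kappa>. \<phi> p \<in> fst \<kappa>'})"
      by (rule smooth_map_open[OF assms(1-3) charts_atD(1)[OF assms(4)] charts_atD(1)[OF assms(5)]])
    show "snd \<kappa> p \<in> snd \<kappa> ` {p \<in> fst \<kappa>. \<phi> p \<in> fst \<kappa>'}"
      using charts_atD(2)[OF assms(4)] charts_atD(2)[OF assms(5)] by blast
    show "(\<phi> \<circ> chart_inv \<kappa>) y \<in> fst \<kappa>'" if "y \<in> snd \<kappa> ` {p \<in> fst \<kappa>. \<phi> p \<in> fst \<kappa>'}" for y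
      using that by (auto simp: chart_inv_chart[OF ch])
    show "(snd \<kappa>' \<circ> (\<phi> \<circ> chart_inv \<kappa>) has_derivative local_derivative \<kappa> \<kappa>' \<phi> p) (at (snd \<kappa> p))"
      using local_derivative_has_derivative[OF assms(3-5)] by (simp only: o_assoc)
  qed (simp_all only: p assms(5,6))
  have D': "((snd \<kappa>'' \<circ> (\<phi> \<circ> chart_inv \<kappa>)) has_derivative local_derivative \<kappa> \<kappa>'' \<phi> p) (at (snd \<kappa> p))"
    using local_derivative_has_derivative[OF assms(3,4,6)] by (simp only: o_assoc)
  show ?thesis using has_derivative_unique[OF D' D] unfolding p .
qed

lemma tangent_map_in_tangent_space:
  assumes "smooth_atlas M" "smooth_atlas N" "smooth_map M N \<phi>" "p \<in> points M"
  shows "tangent_map M N \<phi> p v \<in> tangent_space N (\<phi> p)"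
  unfolding tangent_space_iff
proof (intro conjI allI impI ballI)
  fix \<kappa>' \<kappa>'' assume \<kappa>': "\<kappa>' \<in> charts_at N (\<phi> p)" "\<kappa>'' \<in> charts_at N (\<phi> p)"
  have "local_derivative (chart_at M p) \<kappa>'' \<phi> p (v (chart_at M p)) =
      transition \<kappa>' \<kappa>'' (\<phi> p) (local_derivative (chart_at M p) \<kappa>' \<phi> p (v (chart_at M p)))"
    unfolding local_derivative_change_target[OF assms(1-3) chart_at_in_charts_at[OF assms(1,4)] \<kappa>']
    by (rule o_apply)
  then show "tangent_map M N \<phi> p v \<kappa>'' =
      transition \<kappa>' \<kappa>'' (\<phi> p) (tangent_map M N \<phi> p v \<kappa>')"
    using \<kappa>' by (simp add: tangent_map_def Let_def local_derivative_def)
qed (simp add: tangent_map_def)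

text \<open>In coordinates the pullback is composition with the derivative. The chart at \<open>p\<close> is the one by which
  \<^const>\<open>tangent_map\<close> is defined, while the chart in the target is arbitrary; this freedom is needed on products,
  where the chosen chart at a pair may differ from the product of the chosen charts.\<close>

lemma pullback_covec_coord_covec:
  assumes "smooth_atlas M" "smooth_atlas N" "smooth_map M N \<phi>" "p \<in> points M"
    "\<kappa>' \<in> charts_at N (\<phi> p)"
  shows "pullback_covec M N \<phi> p (coord_covec N (\<phi> p) \<kappa>' B) =
    coord_covec M p (chart_at M p) (B \<circ> local_derivative (chart_at M p) \<kappa>' \<phi> p)"
  by (rule ext) (simp add: pullback_covec_def coord_covec_def
      tangent_map_in_tangent_space[OF assms(1-4)],
      simp add: tangent_map_def assms(5) Let_def local_derivative_def)

lemma linear_local_derivative: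
  "smooth_map M N \<phi> \<Longrightarrow> \<kappa> \<in> charts_at M p \<Longrightarrow> \<kappa>' \<in> charts_at N (\<phi> p)
    \<Longrightarrow> linear (local_derivative \<kappa> \<kappa>' \<phi> p)"
  by (rule has_derivative_linear[OF local_derivative_has_derivative])

lemma pullback_covec_in_cotangent_space:
  assumes "smooth_atlas M" "smooth_atlas N" "smooth_map M N \<phi>" "p \<in> points M"
    "\<alpha> \<in> cotangent_space N (\<phi> p)"
  shows "pullback_covec M N \<phi> p \<alpha> \<in> cotangent_space M p"
proof -
  have \<kappa>': "chart_at N (\<phi> p) \<in> charts_at N (\<phi> p)"
    by (intro chart_at_in_charts_at smooth_map_in_points[OF assms(3)] assms)
  then obtain B where B: "linear B" "\<alpha> = coord_covec N (\<phi> p) (chart_at N (\<phi> p)) B"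
    by (rule cotangent_space_eq_coord_covec[OF assms(2) _ assms(5)])
  show ?thesis
    unfolding B(2) pullback_covec_coord_covec[OF assms(1-4) \<kappa>']
    by (intro coord_covec_in_cotangent_space[OF assms(1)] linear_compose[OF _ B(1)]
        linear_local_derivative[OF assms(3) chart_at_in_charts_at[OF assms(1,4)] \<kappa>'])
qed

section \<open>Products of manifolds\<close>

lemma chart_homeomorphic_maps:
  assumes "is_chart X \<kappa>"
  shows "homeomorphic_maps (subtopology X (fst \<kappa>)) (top_of_set (chart_image \<kappa>)) (snd \<kappa>) (chart_inv \<kappa>)"
  unfolding homeomorphic_maps_def
  using continuous_map_chart[OF assms] continuous_map_chart_inv[OF assms]
  by (simp add: chart_inv_chart[OF assms])

lemma is_chartI:
  assumes "openin X U" "open V" "homeomorphic_maps (subtopology X U) (top_of_set V) f g"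
  shows "is_chart X (U, f)"
proof -
  have h: "homeomorphic_map (subtopology X U) (top_of_set V) f"
    using assms(3) by (rule homeomorphic_maps_imp_map)
  have "f ` U = V"
    using homeomorphic_imp_surjective_map[OF h] openin_subset[OF assms(1)] by (simp add: Int_absorb1)
  then show ?thesis using h assms by (simp add: is_chart_def)
qed

lemma fst_prod_chart: "fst (prod_chart \<kappa> \<kappa>') = fst \<kappa> \<times> fst \<kappa>'"
  and snd_prod_chart: "snd (prod_chart \<kappa> \<kappa>') p = (snd \<kappa> (fst p), snd \<kappa>' (snd p))"
  by (simp_all add: prod_chart_def map_prod_def case_prod_unfold)

lemma is_chart_prod:
  assumes "is_chart X \<kappa>" "is_chart Y \<kappa>'"
  shows "is_chart (prod_topology X Y) (prod_chart \<kappa> \<kappa>')"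
proof -
  have "homeomorphic_maps (subtopology (prod_topology X Y) (fst \<kappa> \<times> fst \<kappa>'))
      (top_of_set (chart_image \<kappa> \<times> chart_image \<kappa>'))
      (\<lambda>(x, y). (snd \<kappa> x, snd \<kappa>' y)) (\<lambda>(x, y). (chart_inv \<kappa> x, chart_inv \<kappa>' y))"
    using homeomorphic_maps_prod chart_homeomorphic_maps[OF assms(1)] chart_homeomorphic_maps[OF assms(2)]
    unfolding subtopology_Times prod_topology_subtopology_eu[symmetric] by blast
  then show ?thesis
    unfolding prod_chart_def map_prod_def
    by (rule is_chartI[rotated 2]) (auto simp: openin_prod_Times_iff open_Times
        chart_openin[OF assms(1)] chart_openin[OF assms(2)]
        open_chart_image[OF assms(1)] open_chart_image[OF assms(2)])
qed

lemma chart_inv_prod: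
  assumes "is_chart X \<kappa>" "is_chart Y \<kappa>'" "x \<in> chart_image \<kappa>" "y \<in> chart_image \<kappa>'"
  shows "chart_inv (prod_chart \<kappa> \<kappa>') (x, y) = (chart_inv \<kappa> x, chart_inv \<kappa>' y)"
proof -
  have "(x, y) = snd (prod_chart \<kappa> \<kappa>') (chart_inv \<kappa> x, chart_inv \<kappa>' y)"
    by (simp only: snd_prod_chart fst_conv snd_conv chart_chart_inv[OF assms(3)] chart_chart_inv[OF assms(4)])
  moreover have "(chart_inv \<kappa> x, chart_inv \<kappa>' y) \<in> fst (prod_chart \<kappa> \<kappa>')"
    unfolding fst_prod_chart by (intro SigmaI chart_inv_in assms)
  ultimately show ?thesis
    using chart_inv_chart[OF is_chart_prod[OF assms(1,2)]] by metis
qed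

lemma finite_dimensional_prod:
  assumes "finite_dimensional TYPE('e::real_vector)" "finite_dimensional TYPE('f::real_vector)"
  shows "finite_dimensional TYPE('e \<times> 'f)"
proof -
  obtain A :: "'e set" and B :: "'f set" where AB: "finite A" "span A = UNIV" "finite B" "span B = UNIV"
    using assms by (auto simp: finite_dimensional_def)
  define C where "C = (\<lambda>a. (a, 0::'f)) ` A \<union> (\<lambda>b. (0::'e, b)) ` B"
  have lin: "linear (\<lambda>a::'e. (a, 0::'f))" "linear (\<lambda>b::'f. (0::'e, b))"
    by (auto intro!: linearI)
  have "(x, y) \<in> span C" for x y
  proof -
    have "(x, 0) \<in> span ((\<lambda>a. (a, 0::'f)) ` A)" "(0, y) \<in> span ((\<lambda>b. (0::'e, b)) ` B)"
      using AB by (simp_all add: linear_span_image[OF lin(1)] linear_span_image[OF lin(2)])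
    then have "(x, 0) \<in> span C" "(0, y) \<in> span C"
      unfolding C_def using span_mono[OF Un_upper1] span_mono[OF Un_upper2] by blast+
    then have "(x, 0) + (0, y) \<in> span C" by (rule span_add)
    then show ?thesis by simp
  qed
  then have "span C = UNIV" by auto
  moreover have "finite C" using AB by (simp add: C_def)
  ultimately show ?thesis unfolding finite_dimensional_def by blast
qed

lemma smooth_on_fst: "open S \<Longrightarrow> smooth_on S fst"
  and smooth_on_snd: "open S \<Longrightarrow> smooth_on S snd"
  by (auto intro: smooth_on_linear bounded_linear_fst bounded_linear_snd)

lemma smooth_on_map_prod:
  fixes f :: "'e::real_inner \<Rightarrow> 'c::real_normed_vector" and g :: "'f::real_inner \<Rightarrow> 'd::real_normed_vector"
  assumes "finite_dimensional TYPE('e)" "finite_dimensional TYPE('f)"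
    "open S" "open T" "smooth_on S f" "smooth_on T g"
  shows "smooth_on (S \<times> T) (\<lambda>x. (f (fst x), g (snd x)))"
  by (intro smooth_on_Pair open_Times assms(3,4) smooth_on_compose[OF assms(1) _ smooth_on_fst assms(5)]
      smooth_on_compose[OF assms(2) _ smooth_on_snd assms(6)]) auto

lemma compatible_prod:
  assumes "smooth_atlas M" "smooth_atlas N"
    "\<kappa>1 \<in> atlas M" "\<kappa>2 \<in> atlas M" "\<kappa>1' \<in> atlas N" "\<kappa>2' \<in> atlas N"
  shows "smooth_on (snd (prod_chart \<kappa>1 \<kappa>1') ` (fst (prod_chart \<kappa>1 \<kappa>1') \<inter> fst (prod_chart \<kappa>2 \<kappa>2')))
    (snd (prod_chart \<kappa>2 \<kappa>2') \<circ> chart_inv (prod_chart \<kappa>1 \<kappa>1'))"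
proof -
  note ch = smooth_atlas_is_chart[OF assms(1,3)] smooth_atlas_is_chart[OF assms(2,5)]
  let ?S = "snd \<kappa>1 ` (fst \<kappa>1 \<inter> fst \<kappa>2)" and ?T = "snd \<kappa>1' ` (fst \<kappa>1' \<inter> fst \<kappa>2')"
  have op: "open ?S" "open ?T"
    using open_chart_overlap[OF assms(1,3,4)] open_chart_overlap[OF assms(2,5,6)] by auto
  have eq: "snd (prod_chart \<kappa>1 \<kappa>1') ` (fst (prod_chart \<kappa>1 \<kappa>1') \<inter> fst (prod_chart \<kappa>2 \<kappa>2')) = ?S \<times> ?T"
    by (simp add: prod_chart_def Times_Int_Times map_prod_surj_on)
  have "smooth_on ?S (snd \<kappa>2 \<circ> chart_inv \<kappa>1)" "smooth_on ?T (snd \<kappa>2' \<circ> chart_inv \<kappa>1')"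
    using smooth_atlas_compatible[OF assms(1,3,4)] smooth_atlas_compatible[OF assms(2,5,6)]
    by (simp_all add: compatible_def)
  from smooth_on_map_prod[OF smooth_atlas_finite_dimensional[OF assms(1)]
      smooth_atlas_finite_dimensional[OF assms(2)] op this]
  show ?thesis unfolding eq
  proof (rule smooth_on_cong)
    fix x assume "x \<in> ?S \<times> ?T"
    then obtain a b where "x = (a, b)" "a \<in> chart_image \<kappa>1" "b \<in> chart_image \<kappa>1'" by blast
    then show "((snd \<kappa>2 \<circ> chart_inv \<kappa>1) (fst x), (snd \<kappa>2' \<circ> chart_inv \<kappa>1') (snd x)) =
        (snd (prod_chart \<kappa>2 \<kappa>2') \<circ> chart_inv (prod_chart \<kappa>1 \<kappa>1')) x"
      by (simp only: o_apply chart_inv_prod[OF ch] snd_prod_chart fst_conv snd_conv)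
  qed (intro open_Times op)
qed

lemma atlas_prodE:
  assumes "K \<in> atlas (prod_manifold M N)"
  obtains \<kappa> \<kappa>' where "\<kappa> \<in> atlas M" "\<kappa>' \<in> atlas N" "K = prod_chart \<kappa> \<kappa>'"
  using assms by (auto simp: prod_manifold_def simp del: split_paired_Ex)

lemma prod_chart_in_atlas:
  "\<kappa> \<in> atlas M \<Longrightarrow> \<kappa>' \<in> atlas N \<Longrightarrow> prod_chart \<kappa> \<kappa>' \<in> atlas (prod_manifold M N)"
  unfolding prod_manifold_def by (simp del: split_paired_Ex) blast

lemma mtop_prod: "mtop (prod_manifold M N) = prod_topology (mtop M) (mtop N)"
  by (simp add: prod_manifold_def)

lemma smooth_atlas_prod:
  assumes "smooth_atlas M" "smooth_atlas N"
  shows "smooth_atlas (prod_manifold M N)"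
  unfolding smooth_atlas_def
proof (intro conjI ballI)
  show "finite_dimensional TYPE('b \<times> 'd)"
    by (rule finite_dimensional_prod[OF smooth_atlas_finite_dimensional[OF assms(1)]
        smooth_atlas_finite_dimensional[OF assms(2)]])
next
  fix K assume "K \<in> atlas (prod_manifold M N)"
  then obtain \<kappa> \<kappa>' where K: "\<kappa> \<in> atlas M" "\<kappa>' \<in> atlas N" "K = prod_chart \<kappa> \<kappa>'"
    by (rule atlas_prodE)
  show "is_chart (mtop (prod_manifold M N)) K"
    unfolding mtop_prod K(3)
    by (rule is_chart_prod[OF smooth_atlas_is_chart[OF assms(1) K(1)] smooth_atlas_is_chart[OF assms(2) K(2)]])
  fix K' assume "K' \<in> atlas (prod_manifold M N)"
  then obtain \<mu> \<mu>' where K': "\<mu> \<in> atlas M" "\<mu>' \<in> atlas N" "K' = prod_chart \<mu> \<mu>'"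
    by (rule atlas_prodE)
  show "compatible K K'"
    unfolding compatible_def K(3) K'(3)
    using compatible_prod[OF assms K(1) K'(1) K(2) K'(2)] compatible_prod[OF assms K'(1) K(1) K'(2) K(2)]
    by (simp only: Int_commute simp_thms)
next
  have "(\<Union>\<kappa>\<in>atlas (prod_manifold M N). fst \<kappa>) = (\<Union>\<kappa>\<in>atlas M. fst \<kappa>) \<times> (\<Union>\<kappa>\<in>atlas N. fst \<kappa>)"
  proof (intro equalityI subsetI)
    fix x assume "x \<in> (\<Union>\<kappa>\<in>atlas (prod_manifold M N). fst \<kappa>)"
    then obtain K where K: "K \<in> atlas (prod_manifold M N)" "x \<in> fst K" by (rule UN_E)
    from K(1) obtain \<kappa> \<kappa>' where "\<kappa> \<in> atlas M" "\<kappa>' \<in> atlas N" "K = prod_chart \<kappa> \<kappa>'"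
      by (rule atlas_prodE)
    then show "x \<in> (\<Union>\<kappa>\<in>atlas M. fst \<kappa>) \<times> (\<Union>\<kappa>\<in>atlas N. fst \<kappa>)"
      using K(2) by (cases x) (simp only: fst_prod_chart mem_Sigma_iff UN_iff, blast)
  next
    fix x assume "x \<in> (\<Union>\<kappa>\<in>atlas M. fst \<kappa>) \<times> (\<Union>\<kappa>\<in>atlas N. fst \<kappa>)"
    then obtain p q \<kappa> \<kappa>' where x: "x = (p, q)" "\<kappa> \<in> atlas M" "p \<in> fst \<kappa>" "\<kappa>' \<in> atlas N" "q \<in> fst \<kappa>'"
      by blast
    show "x \<in> (\<Union>\<kappa>\<in>atlas (prod_manifold M N). fst \<kappa>)"
      by (rule UN_I[OF prod_chart_in_atlas[OF x(2,4)]]) (simp only: fst_prod_chart x(1,3,5) mem_Sigma_iff simp_thms)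
  qed
  then show "(\<Union>\<kappa>\<in>atlas (prod_manifold M N). fst \<kappa>) = points (prod_manifold M N)"
    using assms by (simp add: smooth_atlas_def mtop_prod)
qed

lemma prod_chart_in_charts_at:
  "\<kappa> \<in> charts_at M p \<Longrightarrow> \<kappa>' \<in> charts_at N q \<Longrightarrow> prod_chart \<kappa> \<kappa>' \<in> charts_at (prod_manifold M N) (p, q)"
  unfolding charts_at_def by (simp add: prod_chart_in_atlas fst_prod_chart)

lemma smooth_map_id:
  assumes "smooth_atlas M"
  shows "smooth_map M M (\<lambda>x. x)"
proof -
  have "snd \<kappa>' \<circ> (\<lambda>x. x) \<circ> chart_inv \<kappa> = snd \<kappa>' \<circ> chart_inv \<kappa>"
    "{p \<in> fst \<kappa>. p \<in> fst \<kappa>'} = fst \<kappa> \<inter> fst \<kappa>'" for \<kappa> \<kappa>' :: "('a, 'b) chart"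
    by auto
  then show ?thesis
    using smooth_atlas_compatible[OF assms] by (simp add: smooth_map_def compatible_def)
qed

lemma smooth_map_const:
  assumes "smooth_atlas M" "q \<in> points N"
  shows "smooth_map M N (\<lambda>x. q)"
  unfolding smooth_map_def
proof (intro conjI ballI)
  fix \<kappa> \<kappa>' assume "\<kappa> \<in> atlas M" "\<kappa>' \<in> atlas N"
  have eq: "snd \<kappa>' \<circ> (\<lambda>x. q) \<circ> chart_inv \<kappa> = (\<lambda>x. snd \<kappa>' q)" by auto
  show "smooth_on (snd \<kappa> ` {p \<in> fst \<kappa>. q \<in> fst \<kappa>'}) (snd \<kappa>' \<circ> (\<lambda>x. q) \<circ> chart_inv \<kappa>)"
    unfolding eq using smooth_on_const[OF open_UNIV] by (rule smooth_on_subset) simp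
qed (use assms(2) in simp)

lemma smooth_map_smooth_on:
  "smooth_map M N f \<Longrightarrow> \<kappa> \<in> atlas M \<Longrightarrow> \<kappa>' \<in> atlas N \<Longrightarrow>
     smooth_on (snd \<kappa> ` {p \<in> fst \<kappa>. f p \<in> fst \<kappa>'}) (snd \<kappa>' \<circ> f \<circ> chart_inv \<kappa>)"
  by (simp add: smooth_map_def)

text \<open>Together with constant maps and the identity this yields the inclusions of the factors at a point
  as well as the graph map \<open>x \<mapsto> (x, \<phi> x)\<close>; the derivatives of all three follow from
  \<open>local_derivative_Pair\<close>.\<close>

lemma smooth_map_Pair:
  assumes "smooth_atlas M" "smooth_atlas N" "smooth_atlas P" "smooth_map M N f" "smooth_map M P g"
  shows "smooth_map M (prod_manifold N P) (\<lambda>x. (f x, g x))"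
  unfolding smooth_map_def
proof (intro conjI ballI)
  show "continuous_map (mtop M) (mtop (prod_manifold N P)) (\<lambda>x. (f x, g x))"
    using assms(4,5) by (simp add: mtop_prod smooth_map_def continuous_map_pairedI)
next
  fix \<kappa> K assume \<kappa>: "\<kappa> \<in> atlas M" and K: "K \<in> atlas (prod_manifold N P)"
  from K obtain \<kappa>1 \<kappa>2 where K: "\<kappa>1 \<in> atlas N" "\<kappa>2 \<in> atlas P" "K = prod_chart \<kappa>1 \<kappa>2"
    by (rule atlas_prodE)
  let ?S = "snd \<kappa> ` {p \<in> fst \<kappa>. f p \<in> fst \<kappa>1 \<and> g p \<in> fst \<kappa>2}"
  have "{p \<in> fst \<kappa>. f p \<in> fst \<kappa>1 \<and> g p \<in> fst \<kappa>2} = {p \<in> fst \<kappa>. f p \<in> fst \<kappa>1} \<inter> {p \<in> fst \<kappa>. g p \<in> fst \<kappa>2}"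
    by auto
  then have "openin (mtop M) {p \<in> fst \<kappa>. f p \<in> fst \<kappa>1 \<and> g p \<in> fst \<kappa>2}"
    using smooth_map_openin[OF assms(1,2,4) \<kappa> K(1)] smooth_map_openin[OF assms(1,3,5) \<kappa> K(2)] by auto
  then have op: "open ?S"
    by (rule open_image_chart[OF smooth_atlas_is_chart[OF assms(1) \<kappa>]]) auto
  have "smooth_on ?S (snd \<kappa>1 \<circ> f \<circ> chart_inv \<kappa>)" "smooth_on ?S (snd \<kappa>2 \<circ> g \<circ> chart_inv \<kappa>)"
    by (rule smooth_on_subset[OF smooth_map_smooth_on[OF assms(4) \<kappa> K(1)]], blast)
      (rule smooth_on_subset[OF smooth_map_smooth_on[OF assms(5) \<kappa> K(2)]], blast)
  from smooth_on_Pair[OF op this]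
  show "smooth_on (snd \<kappa> ` {p \<in> fst \<kappa>. (f p, g p) \<in> fst K}) (snd K \<circ> (\<lambda>x. (f x, g x)) \<circ> chart_inv \<kappa>)"
    by (simp add: K(3) fst_prod_chart snd_prod_chart o_def)
qed

lemma local_derivative_identity_map: "local_derivative \<kappa> \<kappa>' (\<lambda>x. x) p = transition \<kappa> \<kappa>' p"
proof -
  have "snd \<kappa>' \<circ> (\<lambda>x. x) \<circ> chart_inv \<kappa> = snd \<kappa>' \<circ> chart_inv \<kappa>" by auto
  then show ?thesis by (simp only: local_derivative_def transition_def)
qed

lemma local_derivative_id:
  "smooth_atlas M \<Longrightarrow> \<kappa> \<in> charts_at M p \<Longrightarrow> local_derivative \<kappa> \<kappa> (\<lambda>x. x) p = (\<lambda>w. w)"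
  by (simp add: local_derivative_identity_map transition_self id_def)

lemma local_derivative_const: "local_derivative \<kappa> \<kappa>' (\<lambda>x. q) p = (\<lambda>w. 0)"
proof -
  have "snd \<kappa>' \<circ> (\<lambda>x. q) \<circ> chart_inv \<kappa> = (\<lambda>x. snd \<kappa>' q)" by auto
  then show ?thesis by (simp only: local_derivative_def frechet_derivative_const)
qed

lemma local_derivative_Pair:
  assumes "smooth_map M N f" "smooth_map M P g"
    "\<kappa> \<in> charts_at M p" "\<kappa>1 \<in> charts_at N (f p)" "\<kappa>2 \<in> charts_at P (g p)"
  shows "local_derivative \<kappa> (prod_chart \<kappa>1 \<kappa>2) (\<lambda>x. (f x, g x)) p =
    (\<lambda>w. (local_derivative \<kappa> \<kappa>1 f p w, local_derivative \<kappa> \<kappa>2 g p w))"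
proof -
  have eq: "snd (prod_chart \<kappa>1 \<kappa>2) \<circ> (\<lambda>x. (f x, g x)) \<circ> chart_inv \<kappa> =
      (\<lambda>x. ((snd \<kappa>1 \<circ> f \<circ> chart_inv \<kappa>) x, (snd \<kappa>2 \<circ> g \<circ> chart_inv \<kappa>) x))"
    by (simp add: snd_prod_chart fun_eq_iff)
  show ?thesis
    unfolding local_derivative_def[of \<kappa> "prod_chart \<kappa>1 \<kappa>2"] eq
    by (rule frechet_derivative_at[symmetric, OF has_derivative_Pair[OF
          local_derivative_has_derivative[OF assms(1,3,4)]
          local_derivative_has_derivative[OF assms(2,3,5)]]])
qed

section \<open>The graph as an embedded submanifold\<close>

text \<open>The maximal atlas is closed under restricting a chart to an open set and composing it with a
  diffeomorphism \<open>\<sigma>\<close> of model domains, with inverse \<open>\<tau>\<close>. This produces slice charts without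
  checking compatibility by hand.\<close>

lemma smooth_chart_reparametrization:
  fixes P :: "('a, 'e::real_inner) manifold" and \<sigma> :: "'e \<Rightarrow> 'e"
  assumes "smooth_atlas P" "\<kappa> \<in> atlas P" "openin (mtop P) W" "W \<subseteq> fst \<kappa>"
    "smooth_on (snd \<kappa> ` W) \<sigma>" "open (\<sigma> ` snd \<kappa> ` W)" "smooth_on (\<sigma> ` snd \<kappa> ` W) \<tau>"
    "\<And>e. e \<in> snd \<kappa> ` W \<Longrightarrow> \<tau> (\<sigma> e) = e"
  shows "smooth_chart P (W, \<sigma> \<circ> snd \<kappa>)"
proof -
  define X where "X = mtop P"
  have ch: "is_chart X \<kappa>" unfolding X_def by (rule smooth_atlas_is_chart[OF assms(1,2)])
  have \<tau>: "\<tau> e \<in> snd \<kappa> ` W" "\<sigma> (\<tau> e) = e" if "e \<in> \<sigma> ` snd \<kappa> ` W" for e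
    using that assms(8) by auto
  have inv: "chart_inv \<kappa> (snd \<kappa> p) = p" if "p \<in> W" for p
    using chart_inv_chart[OF ch] that assms(4) by blast
  have WX: "W \<subseteq> topspace X" using openin_subset[OF assms(3)] by (simp add: X_def)
  have "continuous_map (subtopology X W) euclidean (snd \<kappa>)"
    by (rule continuous_map_from_subtopology_mono[OF continuous_map_into_fulltopology[OF
          continuous_map_chart[OF ch]] assms(4)])
  then have "continuous_map (subtopology X W) (top_of_set (snd \<kappa> ` W)) (snd \<kappa>)"
    using WX by (auto simp: continuous_map_in_subtopology)
  moreover have "continuous_map (top_of_set (snd \<kappa> ` W)) (top_of_set (\<sigma> ` snd \<kappa> ` W)) \<sigma>"
    using smooth_on_imp_continuous_on[OF assms(5)] by (auto simp: continuous_map_in_subtopology)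
  ultimately have c1: "continuous_map (subtopology X W) (top_of_set (\<sigma> ` snd \<kappa> ` W)) (\<sigma> \<circ> snd \<kappa>)"
    by (rule continuous_map_compose)
  have "continuous_map (top_of_set (snd \<kappa> ` W)) X (chart_inv \<kappa>)"
    using continuous_map_from_subtopology_mono[OF continuous_map_into_fulltopology[OF
          continuous_map_chart_inv[OF ch]] image_mono[OF assms(4)]] .
  then have "continuous_map (top_of_set (snd \<kappa> ` W)) (subtopology X W) (chart_inv \<kappa>)"
    using inv by (auto simp: continuous_map_in_subtopology)
  moreover have "continuous_map (top_of_set (\<sigma> ` snd \<kappa> ` W)) (top_of_set (snd \<kappa> ` W)) \<tau>"
    using smooth_on_imp_continuous_on[OF assms(7)] assms(8) by (auto simp: continuous_map_in_subtopology)
  ultimately have c2: "continuous_map (top_of_set (\<sigma> ` snd \<kappa> ` W)) (subtopology X W) (chart_inv \<kappa> \<circ> \<tau>)"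
    by (rule continuous_map_compose[rotated])
  have "is_chart X (W, \<sigma> \<circ> snd \<kappa>)"
  proof (rule is_chartI)
    show "homeomorphic_maps (subtopology X W) (top_of_set (\<sigma> ` snd \<kappa> ` W)) (\<sigma> \<circ> snd \<kappa>) (chart_inv \<kappa> \<circ> \<tau>)"
      unfolding homeomorphic_maps_def using c1 c2 inv assms(8) by auto
    show "openin X W" using assms(3) by (simp only: X_def)
  qed (rule assms(6))
  note ch' = this
  have inv': "chart_inv (W, \<sigma> \<circ> snd \<kappa>) e = chart_inv \<kappa> (\<tau> e)" if "e \<in> \<sigma> ` snd \<kappa> ` W" for e
  proof -
    obtain p where p: "p \<in> W" "e = (\<sigma> \<circ> snd \<kappa>) p" using \<open>e \<in> _\<close> by auto
    then have "chart_inv (W, \<sigma> \<circ> snd \<kappa>) e = p"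
      using chart_inv_chart[OF ch', of p] by simp
    then show ?thesis using p inv assms(8) by simp
  qed
  have "compatible (W, \<sigma> \<circ> snd \<kappa>) \<kappa>'" if \<kappa>': "\<kappa>' \<in> atlas P" for \<kappa>'
  proof -
    note fd = smooth_atlas_finite_dimensional[OF assms(1)]
    have ch2: "is_chart X \<kappa>'" unfolding X_def by (rule smooth_atlas_is_chart[OF assms(1) \<kappa>'])
    have comp: "smooth_on (snd \<kappa> ` (fst \<kappa> \<inter> fst \<kappa>')) (snd \<kappa>' \<circ> chart_inv \<kappa>)"
      "smooth_on (snd \<kappa>' ` (fst \<kappa> \<inter> fst \<kappa>')) (snd \<kappa> \<circ> chart_inv \<kappa>')"
      using smooth_atlas_compatible[OF assms(1,2) \<kappa>'] by (simp_all add: compatible_def)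
    have op: "openin X (W \<inter> fst \<kappa>')"
      by (rule openin_Int[OF _ chart_openin[OF ch2]]) (simp only: X_def assms(3))
    have op1: "open ((\<sigma> \<circ> snd \<kappa>) ` (W \<inter> fst \<kappa>'))"
      using open_image_chart[OF ch' op] by simp
    have op2: "open (snd \<kappa>' ` (W \<inter> fst \<kappa>'))"
      using open_image_chart[OF ch2 op] by simp
    have "smooth_on ((\<sigma> \<circ> snd \<kappa>) ` (W \<inter> fst \<kappa>')) (\<lambda>e. (snd \<kappa>' \<circ> chart_inv \<kappa>) (\<tau> e))"
      by (rule smooth_on_compose[OF fd op1 smooth_on_subset[OF assms(7)] comp(1)])
        (auto simp: assms(8) dest: subsetD[OF assms(4)])
    then have "smooth_on ((\<sigma> \<circ> snd \<kappa>) ` (W \<inter> fst \<kappa>')) (snd \<kappa>' \<circ> chart_inv (W, \<sigma> \<circ> snd \<kappa>))"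
    proof (rule smooth_on_cong[OF _ op1])
      fix e assume "e \<in> (\<sigma> \<circ> snd \<kappa>) ` (W \<inter> fst \<kappa>')"
      then have "e \<in> \<sigma> ` snd \<kappa> ` W" by auto
      from inv'[OF this] show "(snd \<kappa>' \<circ> chart_inv \<kappa>) (\<tau> e) = (snd \<kappa>' \<circ> chart_inv (W, \<sigma> \<circ> snd \<kappa>)) e"
        by (simp only: o_apply)
    qed
    moreover have "smooth_on (snd \<kappa>' ` (W \<inter> fst \<kappa>')) (\<lambda>e. \<sigma> ((snd \<kappa> \<circ> chart_inv \<kappa>') e))"
    proof (rule smooth_on_compose[OF fd op2 smooth_on_subset[OF comp(2)] assms(5)])
      show "(snd \<kappa> \<circ> chart_inv \<kappa>') x \<in> snd \<kappa> ` W" if "x \<in> snd \<kappa>' ` (W \<inter> fst \<kappa>')" for x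
        using that chart_inv_chart[OF ch2] by auto
    qed (use assms(4) in blast)
    ultimately show ?thesis unfolding compatible_def fst_conv snd_conv o_def by (rule conjI)
  qed
  then show ?thesis using ch' unfolding smooth_chart_def X_def by blast
qed

text \<open>With \<open>\<psi>\<close> the coordinate expression of \<open>\<phi>\<close>, the shear \<open>(x, y) \<mapsto> (x, y - \<psi> x)\<close> maps the graph of \<open>\<psi>\<close> to
  the slice \<open>y = 0\<close>. Composed with a product chart it is a slice chart for the graph of \<open>\<phi>\<close>. The
  domain in the first factor is cut down to where \<open>\<psi>\<close> is defined.\<close>

lemma embedded_submanifold_graph:
  assumes "smooth_atlas M" "smooth_atlas N" "smooth_map M N \<phi>"
  shows "embedded_submanifold (prod_manifold M N) (graph_of M \<phi>)"
  unfolding embedded_submanifold_def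
proof (intro conjI exI[of _ "UNIV \<times> {0}"] ballI)
  show "graph_of M \<phi> \<subseteq> points (prod_manifold M N)"
    using smooth_map_in_points[OF assms(3)] by (auto simp: graph_of_def mtop_prod)
  show "subspace (UNIV \<times> {0} :: ('b \<times> 'd) set)"
    by (auto simp: subspace_def zero_prod_def)
  fix x assume "x \<in> graph_of M \<phi>"
  then obtain m where m: "m \<in> points M" "x = (m, \<phi> m)" by (auto simp: graph_of_def)
  obtain \<kappa> \<kappa>' where k: "\<kappa> \<in> charts_at M m" "\<kappa>' \<in> charts_at N (\<phi> m)"
    using chart_at_in_charts_at assms smooth_map_in_points m by metis
  note at = charts_atD(1)[OF k(1)] charts_atD(1)[OF k(2)]
  note ch = charts_at_is_chart[OF assms(1) k(1)] charts_at_is_chart[OF assms(2) k(2)]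
  note fd = smooth_atlas_finite_dimensional[OF assms(1)] smooth_atlas_finite_dimensional[OF assms(2)]
  define U where "U = {p \<in> fst \<kappa>. \<phi> p \<in> fst \<kappa>'}"
  define \<psi> where "\<psi> = snd \<kappa>' \<circ> \<phi> \<circ> chart_inv \<kappa>"
  define \<sigma> where "\<sigma> = (\<lambda>e. (fst e, snd e - \<psi> (fst e)))"
  define \<tau> where "\<tau> = (\<lambda>e. (fst e, snd e + \<psi> (fst e)))"
  define K where "K = prod_chart \<kappa> \<kappa>'"
  define D V where "D = snd \<kappa> ` U" and "V = chart_image \<kappa>'"
  have D: "open D"
    unfolding D_def U_def by (rule smooth_map_open[OF assms at])
  have V: "open V" unfolding V_def by (rule open_chart_image[OF ch(2)])
  have \<psi>: "smooth_on D \<psi>"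
    using assms(3) at by (simp add: smooth_map_def D_def U_def \<psi>_def)
  have \<psi>1: "smooth_on (D \<times> UNIV) (\<lambda>e::'b \<times> 'd. \<psi> (fst e))"
    by (rule smooth_on_compose[OF fd(1) _ smooth_on_fst \<psi>]) (use D in \<open>auto intro: open_Times\<close>)
  have DU: "open (D \<times> (UNIV :: 'd set))" by (intro open_Times D open_UNIV)
  have \<sigma>: "smooth_on (D \<times> UNIV) \<sigma>" and \<tau>: "smooth_on (D \<times> UNIV) \<tau>"
    unfolding \<sigma>_def \<tau>_def
    by (intro smooth_on_Pair smooth_on_diff smooth_on_add smooth_on_fst smooth_on_snd \<psi>1 DU)+
  have KW: "snd K ` (U \<times> fst \<kappa>') = D \<times> V"
    by (simp add: K_def prod_chart_def D_def V_def map_prod_surj_on)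
  \<comment> \<open>The image of the shear is a preimage under its inverse, hence open.\<close>
  have sub: "\<sigma> ` (D \<times> V) = (D \<times> UNIV) \<inter> \<tau> -` (UNIV \<times> V)"
  proof (intro equalityI subsetI)
    fix e assume "e \<in> (D \<times> UNIV) \<inter> \<tau> -` (UNIV \<times> V)"
    then have "e = \<sigma> (\<tau> e)" "\<tau> e \<in> D \<times> V" by (auto simp: \<sigma>_def \<tau>_def)
    then show "e \<in> \<sigma> ` (D \<times> V)" by (rule image_eqI)
  qed (auto simp: \<sigma>_def \<tau>_def)
  have op: "open (\<sigma> ` (D \<times> V))"
    unfolding sub
    by (intro continuous_open_preimage smooth_on_imp_continuous_on \<tau> DU open_Times open_UNIV V)
  have chart: "smooth_chart (prod_manifold M N) (U \<times> fst \<kappa>', \<sigma> \<circ> snd K)"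
  proof (rule smooth_chart_reparametrization[where \<tau>=\<tau>])
    show "smooth_atlas (prod_manifold M N)" by (rule smooth_atlas_prod[OF assms(1,2)])
    show "K \<in> atlas (prod_manifold M N)" unfolding K_def by (rule prod_chart_in_atlas[OF at])
    show "openin (mtop (prod_manifold M N)) (U \<times> fst \<kappa>')"
      using smooth_map_openin[OF assms at] chart_openin[OF ch(2)]
      by (simp add: mtop_prod openin_prod_Times_iff U_def)
    show "U \<times> fst \<kappa>' \<subseteq> fst K" by (auto simp: K_def fst_prod_chart U_def)
    show "smooth_on (snd K ` (U \<times> fst \<kappa>')) \<sigma>"
      unfolding KW by (rule smooth_on_subset[OF \<sigma>]) auto
    show "open (\<sigma> ` snd K ` (U \<times> fst \<kappa>'))" unfolding KW by (rule op)
    show "smooth_on (\<sigma> ` snd K ` (U \<times> fst \<kappa>')) \<tau>"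
      unfolding KW sub by (rule smooth_on_subset[OF \<tau>]) auto
    show "\<tau> (\<sigma> e) = e" for e by (simp add: \<sigma>_def \<tau>_def)
  qed
  have val: "(\<sigma> \<circ> snd K) (p, q) = (snd \<kappa> p, snd \<kappa>' q - snd \<kappa>' (\<phi> p))" if "p \<in> U" for p q
    using that chart_inv_chart[OF ch(1)] by (simp add: \<sigma>_def K_def snd_prod_chart \<psi>_def U_def)
  have "(\<sigma> \<circ> snd K) ` ((U \<times> fst \<kappa>') \<inter> graph_of M \<phi>) = (\<sigma> \<circ> snd K) ` (U \<times> fst \<kappa>') \<inter> (UNIV \<times> {0})"
  proof (intro equalityI subsetI)
    fix e assume "e \<in> (\<sigma> \<circ> snd K) ` ((U \<times> fst \<kappa>') \<inter> graph_of M \<phi>)"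
    then obtain p where p: "p \<in> U" "\<phi> p \<in> fst \<kappa>'" "e = (\<sigma> \<circ> snd K) (p, \<phi> p)"
      by (auto simp: graph_of_def)
    have "e \<in> (\<sigma> \<circ> snd K) ` (U \<times> fst \<kappa>')"
      unfolding p(3) by (intro imageI SigmaI p(1,2))
    moreover have "e \<in> UNIV \<times> {0}"
      unfolding p(3) val[OF p(1)] by simp
    ultimately show "e \<in> (\<sigma> \<circ> snd K) ` (U \<times> fst \<kappa>') \<inter> (UNIV \<times> {0})" by (rule IntI)
  next
    fix e assume e: "e \<in> (\<sigma> \<circ> snd K) ` (U \<times> fst \<kappa>') \<inter> (UNIV \<times> {0})"
    then obtain x where x: "x \<in> U \<times> fst \<kappa>'" "e = (\<sigma> \<circ> snd K) x" by blast
    obtain p q where "x = (p, q)" by (cases x)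
    with x have p: "p \<in> U" "q \<in> fst \<kappa>'" "e = (\<sigma> \<circ> snd K) (p, q)" by simp_all
    have "snd e = 0" using e by (simp add: mem_Times_iff)
    then have "snd \<kappa>' q = snd \<kappa>' (\<phi> p)" unfolding p(3) val[OF p(1)] by simp
    then have "q = \<phi> p"
      using inj_onD[OF chart_inj[OF ch(2)]] p by (simp add: U_def)
    moreover have "p \<in> points M" using p(1) chart_subset[OF ch(1)] by (auto simp: U_def)
    ultimately show "e \<in> (\<sigma> \<circ> snd K) ` ((U \<times> fst \<kappa>') \<inter> graph_of M \<phi>)"
      using p by (auto simp: graph_of_def)
  qed
  moreover have "x \<in> U \<times> fst \<kappa>'"
    using charts_atD(2)[OF k(1)] charts_atD(2)[OF k(2)] by (simp add: m U_def)
  ultimately show "\<exists>\<kappa>. smooth_chart (prod_manifold M N) \<kappa> \<and> x \<in> fst \<kappa> \<and>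
      snd \<kappa> ` (fst \<kappa> \<inter> graph_of M \<phi>) = chart_image \<kappa> \<inter> (UNIV \<times> {0})"
    using chart by (intro exI[of _ "(U \<times> fst \<kappa>', \<sigma> \<circ> snd K)"]) simp
qed

section \<open>Curves and the tangent space of the graph\<close>

lemma velocity_smooth_map:
  assumes "smooth_atlas M" "smooth_map M N f" "\<kappa> \<in> charts_at M (c t)" "\<kappa>' \<in> charts_at N (f (c t))"
    "open T" "t \<in> T" "\<And>s. s \<in> T \<Longrightarrow> c s \<in> fst \<kappa>"
    "((snd \<kappa> \<circ> c) has_vector_derivative w) (at t)"
  shows "((snd \<kappa>' \<circ> f \<circ> c) has_vector_derivative local_derivative \<kappa> \<kappa>' f (c t) w) (at t)"
proof -
  note ch = charts_at_is_chart[OF assms(1,3)]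
  have "((snd \<kappa>' \<circ> f \<circ> chart_inv \<kappa>) \<circ> (snd \<kappa> \<circ> c) has_vector_derivative
      local_derivative \<kappa> \<kappa>' f (c t) w) (at t)"
  proof (rule vector_derivative_diff_chain_within[OF assms(8)])
    show "((snd \<kappa>' \<circ> f \<circ> chart_inv \<kappa>) has_derivative local_derivative \<kappa> \<kappa>' f (c t))
        (at ((snd \<kappa> \<circ> c) t) within range (snd \<kappa> \<circ> c))"
      unfolding o_apply[of "snd \<kappa>" c]
      by (rule has_derivative_at_withinI[OF local_derivative_has_derivative[OF assms(2-4)]])
  qed
  then show ?thesis
    by (rule has_vector_derivative_transform_within_open[OF _ assms(5,6)])
      (simp add: chart_inv_chart[OF ch] assms(7))
qed

lemma open_curve_preimage:
  assumes "smooth_curve M \<epsilon> c" "openin (mtop M) U"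
  shows "open {t \<in> {-\<epsilon><..<\<epsilon>}. c t \<in> U}"
proof -
  have "continuous_map (top_of_set {-\<epsilon><..<\<epsilon>}) (mtop M) c"
    using assms(1) by (simp add: smooth_curve_def)
  from openin_continuous_map_preimage[OF this assms(2)]
  show ?thesis
    using openin_open_trans[OF _ open_greaterThanLessThan] by (simp only: topspace_euclidean_subtopology)
qed

text \<open>The curve is a straight line in one chart. Its velocity in every other chart is correct because
  the transition maps act on velocities as they act on tangent vectors.\<close>

lemma smooth_curve_through_tangent_vector:
  assumes "smooth_atlas M" "p \<in> points M" "v \<in> tangent_space M p"
  obtains \<epsilon> c where "\<epsilon> > 0" "smooth_curve M \<epsilon> c" "c 0 = p"
    "\<And>\<kappa>'. \<kappa>' \<in> charts_at M p \<Longrightarrow> ((snd \<kappa>' \<circ> c) has_vector_derivative v \<kappa>') (at 0)"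
proof -
  define \<kappa> where "\<kappa> = chart_at M p"
  have \<kappa>: "\<kappa> \<in> charts_at M p" unfolding \<kappa>_def by (rule chart_at_in_charts_at[OF assms(1,2)])
  note at = charts_atD(1)[OF \<kappa>] and p = charts_atD(2)[OF \<kappa>]
  note ch = charts_at_is_chart[OF assms(1) \<kappa>]
  define l where "l = (\<lambda>t. snd \<kappa> p + t *\<^sub>R v \<kappa>)"
  define c where "c = (\<lambda>t. chart_inv \<kappa> (l t))"
  have l: "smooth_on UNIV l"
    unfolding l_def by (intro smooth_on_add smooth_on_const smooth_on_linear
        bounded_linear_scaleR_left open_UNIV)
  have lcont: "continuous_on UNIV l" by (rule smooth_on_imp_continuous_on[OF l])
  have "open (l -` chart_image \<kappa>)"
    by (rule open_vimage[OF open_chart_image[OF ch] lcont])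
  moreover have "0 \<in> l -` chart_image \<kappa>" using p by (simp add: l_def)
  ultimately obtain \<epsilon> where \<epsilon>: "\<epsilon> > 0" "ball 0 \<epsilon> \<subseteq> l -` chart_image \<kappa>"
    unfolding open_contains_ball by blast
  define I where "I = {-\<epsilon><..<\<epsilon>}"
  have I: "ball 0 \<epsilon> = I" by (simp add: ball_eq_greaterThanLessThan I_def)
  have lI: "l t \<in> chart_image \<kappa>" if "t \<in> I" for t
    using \<epsilon>(2) that unfolding I by blast
  have c0: "c 0 = p" by (simp add: c_def l_def chart_inv_chart[OF ch p])
  have cI: "c t \<in> fst \<kappa>" "snd \<kappa> (c t) = l t" if "t \<in> I" for t
    unfolding c_def by (rule chart_inv_in[OF lI[OF that]], rule chart_chart_inv[OF lI[OF that]])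
  have "continuous_map (top_of_set I) (top_of_set (chart_image \<kappa>)) l"
    using continuous_on_subset[OF lcont, of I] lI by (auto simp: continuous_map_in_subtopology)
  from continuous_map_compose[OF this continuous_map_into_fulltopology[OF continuous_map_chart_inv[OF ch]]]
  have cont: "continuous_map (top_of_set I) (mtop M) c" by (simp add: c_def o_def)
  have curve: "smooth_curve M \<epsilon> c"
    unfolding smooth_curve_def I_def[symmetric]
  proof (intro conjI ballI cont)
    fix \<kappa>' assume \<kappa>': "\<kappa>' \<in> atlas M"
    define T where "T = {t \<in> I. c t \<in> fst \<kappa>'}"
    have "openin (top_of_set I) T"
      using openin_continuous_map_preimage[OF cont chart_openin[OF smooth_atlas_is_chart[OF assms(1) \<kappa>']]]
      by (simp add: T_def)
    then have T: "open T"
      by (rule openin_open_trans) (simp add: I_def)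
    have "smooth_on T (\<lambda>t. (snd \<kappa>' \<circ> chart_inv \<kappa>) (l t))"
    proof (rule smooth_on_compose[OF smooth_atlas_finite_dimensional[OF assms(1)] T smooth_on_subset[OF l]])
      show "smooth_on (snd \<kappa> ` (fst \<kappa> \<inter> fst \<kappa>')) (snd \<kappa>' \<circ> chart_inv \<kappa>)"
        using smooth_atlas_compatible[OF assms(1) at \<kappa>'] by (simp add: compatible_def)
      show "l t \<in> snd \<kappa> ` (fst \<kappa> \<inter> fst \<kappa>')" if "t \<in> T" for t
      proof (rule image_eqI)
        show "l t = snd \<kappa> (c t)" using cI(2)[of t] that by (simp add: T_def)
        show "c t \<in> fst \<kappa> \<inter> fst \<kappa>'" using cI(1)[of t] that by (simp add: T_def)
      qed
    qed simp
    then show "smooth_on {t \<in> I. c t \<in> fst \<kappa>'} (snd \<kappa>' \<circ> c)"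
      by (simp add: T_def c_def o_def)
  qed
  have "((\<lambda>t. snd \<kappa> p + t *\<^sub>R v \<kappa>) has_vector_derivative v \<kappa>) (at 0)"
    by (auto intro!: derivative_eq_intros)
  then have vel: "((snd \<kappa> \<circ> c) has_vector_derivative v \<kappa>) (at 0)"
    by (rule has_vector_derivative_transform_within_open[of _ _ _ I])
      (use \<epsilon>(1) cI(2) in \<open>auto simp: I_def l_def\<close>)
  have "((snd \<kappa>' \<circ> c) has_vector_derivative v \<kappa>') (at 0)" if \<kappa>': "\<kappa>' \<in> charts_at M p" for \<kappa>'
  proof -
    have "((snd \<kappa>' \<circ> (\<lambda>x. x) \<circ> c) has_vector_derivative local_derivative \<kappa> \<kappa>' (\<lambda>x. x) (c 0) (v \<kappa>)) (at 0)"
      by (rule velocity_smooth_map[OF assms(1) smooth_map_id[OF assms(1)], where T=I])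
        (use \<kappa> \<kappa>' c0 vel cI(1) \<epsilon>(1) in \<open>simp_all add: I_def\<close>)
    moreover have "snd \<kappa>' \<circ> (\<lambda>x. x) \<circ> c = snd \<kappa>' \<circ> c" by auto
    moreover have "transition \<kappa> \<kappa>' p (v \<kappa>) = v \<kappa>'"
      using assms(3) \<kappa> \<kappa>' unfolding tangent_space_iff by metis
    ultimately show ?thesis by (simp only: local_derivative_identity_map c0)
  qed
  then show thesis using that[OF \<epsilon>(1) curve c0] by blast
qed

text \<open>A curve need not stay in one chart of the source, so smoothness is checked near each parameter in
  a chart of the source at the corresponding point.\<close>

lemma smooth_curve_compose:
  assumes "smooth_atlas M" "smooth_atlas N" "smooth_map M N f" "smooth_curve M \<epsilon> c"
  shows "smooth_curve N \<epsilon> (\<lambda>t. f (c t))"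
  unfolding smooth_curve_def
proof (intro conjI ballI)
  have cont: "continuous_map (top_of_set {-\<epsilon><..<\<epsilon>}) (mtop M) c"
    using assms(4) by (simp add: smooth_curve_def)
  show "continuous_map (top_of_set {-\<epsilon><..<\<epsilon>}) (mtop N) (\<lambda>t. f (c t))"
    using continuous_map_compose[OF cont, of "mtop N" f] assms(3) by (simp add: smooth_map_def o_def)
  fix \<kappa>' assume \<kappa>': "\<kappa>' \<in> atlas N"
  show "smooth_on {t \<in> {-\<epsilon><..<\<epsilon>}. f (c t) \<in> fst \<kappa>'} (snd \<kappa>' \<circ> (\<lambda>t. f (c t)))"
  proof (rule smooth_on_locally)
    fix t assume t: "t \<in> {t \<in> {-\<epsilon><..<\<epsilon>}. f (c t) \<in> fst \<kappa>'}"
    then have "c t \<in> points M"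
      using cont by (auto simp: continuous_map_def)
    from chart_at_in_charts_at[OF assms(1) this]
    obtain \<kappa> where \<kappa>c: "\<kappa> \<in> charts_at M (c t)" ..
    note \<kappa> = charts_atD(1)[OF \<kappa>c] and ct = charts_atD(2)[OF \<kappa>c]
    note ch = charts_at_is_chart[OF assms(1) \<kappa>c]
    define T where "T = {s \<in> {-\<epsilon><..<\<epsilon>}. c s \<in> {p \<in> fst \<kappa>. f p \<in> fst \<kappa>'}}"
    have T: "open T"
      unfolding T_def by (rule open_curve_preimage[OF assms(4) smooth_map_openin[OF assms(1-3) \<kappa> \<kappa>']])
    have "smooth_on {s \<in> {-\<epsilon><..<\<epsilon>}. c s \<in> fst \<kappa>} (snd \<kappa> \<circ> c)"
      using assms(4) \<kappa> unfolding smooth_curve_def by blast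
    then have "smooth_on T (snd \<kappa> \<circ> c)"
      by (rule smooth_on_subset) (auto simp: T_def)
    from smooth_on_compose[OF smooth_atlas_finite_dimensional[OF assms(1)] T this
        smooth_map_smooth_on[OF assms(3) \<kappa> \<kappa>']]
    have "smooth_on T (\<lambda>s. (snd \<kappa>' \<circ> f \<circ> chart_inv \<kappa>) ((snd \<kappa> \<circ> c) s))"
      by (auto simp: T_def)
    then have "smooth_on T (snd \<kappa>' \<circ> (\<lambda>t. f (c t)))"
      by (rule smooth_on_cong[OF _ T]) (auto simp: T_def chart_inv_chart[OF ch])
    moreover have "t \<in> T" using t ct by (simp add: T_def)
    ultimately show "\<exists>T. open T \<and> t \<in> T \<and> smooth_on T (snd \<kappa>' \<circ> (\<lambda>t. f (c t)))"
      using T by blast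
  qed
qed

text \<open>In product coordinates the tangent space of the graph is the graph of the derivative. A curve in
  the graph has the form \<open>t \<mapsto> (c t, \<phi> (c t))\<close>, so the second component of its velocity is the derivative
  of \<open>\<phi>\<close> applied to the first. Conversely, any such vector is the velocity of the curve obtained by
  composing the graph map with a curve of the given velocity in \<open>M\<close>.\<close>

lemma submanifold_tangent_space_graph:
  assumes M: "smooth_atlas M" and N: "smooth_atlas N" and \<phi>: "smooth_map M N \<phi>" and m: "m \<in> points M"
    and \<kappa>: "\<kappa> \<in> charts_at M m" and \<kappa>': "\<kappa>' \<in> charts_at N (\<phi> m)"
  defines "P \<equiv> prod_manifold M N" and "K \<equiv> prod_chart \<kappa> \<kappa>'"
  shows "v \<in> submanifold_tangent_space P (graph_of M \<phi>) (m, \<phi> m) \<longleftrightarrow>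
    v \<in> tangent_space P (m, \<phi> m) \<and> snd (v K) = local_derivative \<kappa> \<kappa>' \<phi> m (fst (v K))"
proof -
  have P: "smooth_atlas P" unfolding P_def by (rule smooth_atlas_prod[OF M N])
  have K: "K \<in> charts_at P (m, \<phi> m)"
    unfolding P_def K_def by (rule prod_chart_in_charts_at[OF \<kappa> \<kappa>'])
  note ch = charts_at_is_chart[OF M \<kappa>]
  show ?thesis
  proof
    assume "v \<in> submanifold_tangent_space P (graph_of M \<phi>) (m, \<phi> m)"
    then obtain \<epsilon> \<gamma> where v: "v \<in> tangent_space P (m, \<phi> m)" and \<epsilon>: "\<epsilon> > 0"
      and \<gamma>: "smooth_curve P \<epsilon> \<gamma>" "\<gamma> ` {-\<epsilon><..<\<epsilon>} \<subseteq> graph_of M \<phi>" "\<gamma> 0 = (m, \<phi> m)"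
        "\<forall>\<kappa>\<in>charts_at P (m, \<phi> m). ((snd \<kappa> \<circ> \<gamma>) has_vector_derivative v \<kappa>) (at 0)"
      unfolding submanifold_tangent_space_def by blast
    define c where "c = (\<lambda>t. fst (\<gamma> t))"
    have c0: "c 0 = m" by (simp add: c_def \<gamma>(3))
    have c: "snd (\<gamma> t) = \<phi> (c t)" if "t \<in> {-\<epsilon><..<\<epsilon>}" for t
    proof -
      have "\<gamma> t \<in> graph_of M \<phi>" using \<gamma>(2) that by blast
      then show ?thesis by (auto simp: graph_of_def c_def)
    qed
    define T where "T = {t \<in> {-\<epsilon><..<\<epsilon>}. \<gamma> t \<in> fst \<kappa> \<times> points N}"
    have T: "open T"
      unfolding T_def
      by (rule open_curve_preimage[OF \<gamma>(1)])
        (simp add: P_def mtop_prod openin_prod_Times_iff chart_openin[OF ch])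
    have T0: "0 \<in> T"
      using \<epsilon> charts_atD(2)[OF \<kappa>] smooth_map_in_points[OF \<phi> m] by (simp add: T_def \<gamma>(3))
    have Tc: "t \<in> {-\<epsilon><..<\<epsilon>}" "c t \<in> fst \<kappa>" if "t \<in> T" for t
      using that by (auto simp: T_def c_def)
    have vK: "((\<lambda>t. snd K (\<gamma> t)) has_vector_derivative v K) (at 0)"
      using \<gamma>(4) K unfolding o_def by blast
    have "((\<lambda>t. fst (snd K (\<gamma> t))) has_vector_derivative fst (v K)) (at 0)"
      by (rule bounded_linear.has_vector_derivative[OF bounded_linear_fst vK])
    then have "((snd \<kappa> \<circ> c) has_vector_derivative fst (v K)) (at 0)"
      by (simp add: K_def snd_prod_chart c_def o_def)
    then have "((snd \<kappa>' \<circ> \<phi> \<circ> c) has_vector_derivative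
        local_derivative \<kappa> \<kappa>' \<phi> (c 0) (fst (v K))) (at 0)"
      by (intro velocity_smooth_map[OF M \<phi> _ _ T T0 Tc(2)]) (simp_all only: c0 \<kappa> \<kappa>')
    then have "((snd \<kappa>' \<circ> \<phi> \<circ> c) has_vector_derivative
        local_derivative \<kappa> \<kappa>' \<phi> m (fst (v K))) (at 0)"
      unfolding c0 .
    moreover have "((snd \<kappa>' \<circ> \<phi> \<circ> c) has_vector_derivative snd (v K)) (at 0)"
    proof (rule has_vector_derivative_transform_within_open[OF _ T T0])
      show "((\<lambda>t. snd (snd K (\<gamma> t))) has_vector_derivative snd (v K)) (at 0)"
        by (rule bounded_linear.has_vector_derivative[OF bounded_linear_snd vK])
      show "snd (snd K (\<gamma> t)) = (snd \<kappa>' \<circ> \<phi> \<circ> c) t" if "t \<in> T" for t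
        by (simp add: K_def snd_prod_chart c[OF Tc(1)[OF that]])
    qed
    ultimately have "snd (v K) = local_derivative \<kappa> \<kappa>' \<phi> m (fst (v K))"
      using vector_derivative_unique_at by blast
    with v show "v \<in> tangent_space P (m, \<phi> m) \<and> snd (v K) = local_derivative \<kappa> \<kappa>' \<phi> m (fst (v K))"
      by blast
  next
    assume v: "v \<in> tangent_space P (m, \<phi> m) \<and> snd (v K) = local_derivative \<kappa> \<kappa>' \<phi> m (fst (v K))"
    define g where "g = (\<lambda>x. (x, \<phi> x))"
    have g: "smooth_map M P g"
      unfolding g_def P_def by (rule smooth_map_Pair[OF M M N smooth_map_id[OF M] \<phi>])
    define u where "u = tangent_vector M m \<kappa> (fst (v K))"
    have u: "u \<in> tangent_space M m" "u \<kappa> = fst (v K)"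
      unfolding u_def by (rule tangent_vector_in_tangent_space[OF M \<kappa>], rule tangent_vector_same_chart[OF M \<kappa>])
    obtain \<epsilon> c where \<epsilon>: "\<epsilon> > 0" and c: "smooth_curve M \<epsilon> c" "c 0 = m"
      "\<And>\<mu>. \<mu> \<in> charts_at M m \<Longrightarrow> ((snd \<mu> \<circ> c) has_vector_derivative u \<mu>) (at 0)"
      using smooth_curve_through_tangent_vector[OF M m u(1)] by blast
    have gK: "local_derivative \<kappa> K g m (u \<kappa>) = v K"
    proof -
      have "local_derivative \<kappa> K g m (u \<kappa>) = (fst (v K), local_derivative \<kappa> \<kappa>' \<phi> m (fst (v K)))"
        unfolding K_def g_def u(2)[unfolded K_def]
          local_derivative_Pair[OF smooth_map_id[OF M] \<phi> \<kappa> \<kappa> \<kappa>'] local_derivative_id[OF M \<kappa>] ..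
      then show ?thesis using v by (simp add: prod_eq_iff)
    qed
    have gm: "g (c 0) = (m, \<phi> m)" by (simp add: g_def c(2))
    define T where "T = {t \<in> {-\<epsilon><..<\<epsilon>}. c t \<in> fst \<kappa>}"
    have T: "open T" unfolding T_def by (rule open_curve_preimage[OF c(1) chart_openin[OF ch]])
    have T0: "0 \<in> T" using \<epsilon> charts_atD(2)[OF \<kappa>] by (simp add: T_def c(2))
    have vel: "((snd \<mu> \<circ> (\<lambda>t. g (c t))) has_vector_derivative v \<mu>) (at 0)"
      if \<mu>: "\<mu> \<in> charts_at P (m, \<phi> m)" for \<mu>
    proof -
      have "((snd \<mu> \<circ> g \<circ> c) has_vector_derivative local_derivative \<kappa> \<mu> g (c 0) (u \<kappa>)) (at 0)"
      proof (rule velocity_smooth_map[OF M g _ _ T T0])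
        show "\<kappa> \<in> charts_at M (c 0)" unfolding c(2) by (rule \<kappa>)
        show "\<mu> \<in> charts_at P (g (c 0))" unfolding gm by (rule \<mu>)
        show "((snd \<kappa> \<circ> c) has_vector_derivative u \<kappa>) (at 0)" by (rule c(3)[OF \<kappa>])
      qed (simp add: T_def)
      moreover have "local_derivative \<kappa> \<mu> g m (u \<kappa>) = v \<mu>"
      proof -
        have gm': "g m = (m, \<phi> m)" by (simp add: g_def)
        have "local_derivative \<kappa> \<mu> g m (u \<kappa>) = transition K \<mu> (m, \<phi> m) (v K)"
          using local_derivative_change_target[OF M P g \<kappa>, of K \<mu>] K \<mu> gK unfolding gm' by simp
        also have "\<dots> = v \<mu>" using v K \<mu> unfolding tangent_space_iff by metis
        finally show ?thesis .
      qed
      ultimately show ?thesis by (simp only: c(2) o_def)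
    qed
    have "smooth_curve P \<epsilon> (\<lambda>t. g (c t))" by (rule smooth_curve_compose[OF M P g c(1)])
    moreover have "(\<lambda>t. g (c t)) ` {-\<epsilon><..<\<epsilon>} \<subseteq> graph_of M \<phi>"
    proof -
      have "c t \<in> points M" if "t \<in> {-\<epsilon><..<\<epsilon>}" for t
        using c(1) that by (auto simp: smooth_curve_def continuous_map_def)
      then show ?thesis by (auto simp: g_def graph_of_def)
    qed
    ultimately show "v \<in> submanifold_tangent_space P (graph_of M \<phi>) (m, \<phi> m)"
      unfolding submanifold_tangent_space_def using v \<epsilon> gm vel by blast
  qed
qed

section \<open>Covectors as differentials of global functions\<close>

lemma differential_eq_coord_covec:
  "differential N f q = coord_covec N q (chart_at N q)
     (frechet_derivative (f \<circ> chart_inv (chart_at N q)) (at (snd (chart_at N q) q)))"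
  unfolding differential_def coord_covec_def Let_def by (rule refl)

text \<open>The required function is a bump function in a chart, with the prescribed derivative, extended by
  \<open>0\<close>. Its carrier lies in the preimage of a closed ball; this is compact, hence closed because the
  manifold is Hausdorff. A point outside the chart domain therefore has a neighbourhood on which the
  extension vanishes.\<close>

lemma covector_eq_differential:
  assumes "smooth_manifold N" "q \<in> points N" "\<eta> \<in> cotangent_space N q"
  obtains f where "f \<in> smooth_functions N" "differential N f q = \<eta>"
proof -
  have N: "smooth_atlas N" by (rule smooth_manifold_imp_smooth_atlas[OF assms(1)])
  note fd = smooth_atlas_finite_dimensional[OF N]
  define \<kappa> where "\<kappa> = chart_at N q"
  have \<kappa>: "\<kappa> \<in> charts_at N q" unfolding \<kappa>_def by (rule chart_at_in_charts_at[OF N assms(2)])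
  note at = charts_atD(1)[OF \<kappa>] and q = charts_atD(2)[OF \<kappa>]
  note ch = charts_at_is_chart[OF N \<kappa>]
  obtain B where B: "linear B" "\<eta> = coord_covec N q \<kappa> B"
    by (rule cotangent_space_eq_coord_covec[OF N \<kappa> assms(3)])
  have "snd \<kappa> q \<in> chart_image \<kappa>" using q by (rule imageI)
  then obtain r where r: "r > 0" "cball (snd \<kappa> q) r \<subseteq> chart_image \<kappa>"
    using open_chart_image[OF ch] unfolding open_contains_cball by blast
  obtain g where g: "smooth_on UNIV g" "\<And>x. x \<notin> cball (snd \<kappa> q) r \<Longrightarrow> g x = 0"
    "(g has_derivative B) (at (snd \<kappa> q))"
    by (rule bump_function[OF linear_imp_bounded_linear[OF fd B(1)] r(1), of "snd \<kappa> q"]) (rule that)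
  define f where "f = (\<lambda>p. if p \<in> fst \<kappa> then g (snd \<kappa> p) else 0)"
  define C where "C = chart_inv \<kappa> ` cball (snd \<kappa> q) r"
  have "compactin (top_of_set (chart_image \<kappa>)) (cball (snd \<kappa> q) r)"
    using compact_cball_finite_dimensional[OF fd] r(2) by (simp add: compactin_subtopology)
  then have "compactin (mtop N) C"
    unfolding C_def
    by (rule image_compactin[OF _ continuous_map_into_fulltopology[OF continuous_map_chart_inv[OF ch]]])
  then have C: "closedin (mtop N) C"
    using assms(1) by (intro compactin_imp_closedin) (simp_all add: smooth_manifold_def)
  have CV: "C \<subseteq> fst \<kappa>"
  proof
    fix p assume "p \<in> C"
    then obtain e where "e \<in> cball (snd \<kappa> q) r" "p = chart_inv \<kappa> e" unfolding C_def by blast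
    then show "p \<in> fst \<kappa>" using chart_inv_in[OF subsetD[OF r(2)]] by simp
  qed
  have f0: "f p = 0" if "p \<notin> C" for p
  proof (cases "p \<in> fst \<kappa>")
    case True
    have "snd \<kappa> p \<notin> cball (snd \<kappa> q) r"
    proof
      assume "snd \<kappa> p \<in> cball (snd \<kappa> q) r"
      then have "chart_inv \<kappa> (snd \<kappa> p) \<in> C" unfolding C_def by (rule imageI)
      then show False using that chart_inv_chart[OF ch True] by simp
    qed
    then show ?thesis using True g(2) by (simp add: f_def)
  qed (simp add: f_def)
  have "smooth_on (chart_image \<kappa>') (f \<circ> chart_inv \<kappa>')" if \<kappa>': "\<kappa>' \<in> atlas N" for \<kappa>'
  proof (rule smooth_on_locally)
    note ch' = smooth_atlas_is_chart[OF N \<kappa>']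
    fix e assume "e \<in> chart_image \<kappa>'"
    then obtain p where p: "p \<in> fst \<kappa>'" "e = snd \<kappa>' p" by blast
    show "\<exists>T. open T \<and> e \<in> T \<and> smooth_on T (f \<circ> chart_inv \<kappa>')"
    proof (cases "p \<in> fst \<kappa>")
      case True
      define T where "T = snd \<kappa>' ` (fst \<kappa>' \<inter> fst \<kappa>)"
      have T: "open T" unfolding T_def by (rule open_chart_overlap[OF N \<kappa>' at])
      have "smooth_on T (snd \<kappa> \<circ> chart_inv \<kappa>')"
        using smooth_atlas_compatible[OF N \<kappa>' at] by (simp add: compatible_def T_def)
      from smooth_on_compose[OF fd T this g(1) UNIV_I]
      have "smooth_on T (f \<circ> chart_inv \<kappa>')"
        by (rule smooth_on_cong[OF _ T]) (auto simp: T_def f_def chart_inv_chart[OF ch'])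
      then show ?thesis using T p True unfolding T_def by blast
    next
      case False
      define T where "T = snd \<kappa>' ` (fst \<kappa>' - C)"
      have T: "open T"
        unfolding T_def
        by (rule open_image_chart[OF ch' openin_diff[OF chart_openin[OF ch'] C]]) blast
      have "smooth_on T (f \<circ> chart_inv \<kappa>')"
        by (rule smooth_on_cong[OF smooth_on_const[OF T, of 0] T])
          (auto simp: T_def f0 chart_inv_chart[OF ch'])
      moreover have "e \<in> T" using p False CV unfolding T_def by blast
      ultimately show ?thesis using T by blast
    qed
  qed
  then have "f \<in> smooth_functions N" by (simp add: smooth_functions_def)
  moreover have "differential N f q = \<eta>"
  proof -
    have "((f \<circ> chart_inv \<kappa>) has_derivative B) (at (snd \<kappa> q))"
      by (rule has_derivative_transform_within_open[OF g(3) open_chart_image[OF ch]])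
        (use q in \<open>auto simp: f_def chart_inv_chart[OF ch]\<close>)
    from frechet_derivative_at[OF this, symmetric] show ?thesis
      unfolding differential_eq_coord_covec \<kappa>_def[symmetric] B(2) by (rule arg_cong)
  qed
  ultimately show thesis by (rule that)
qed

lemma smooth_function_has_derivative:
  assumes "f \<in> smooth_functions N" "\<kappa> \<in> charts_at N q"
  shows "((f \<circ> chart_inv \<kappa>) has_derivative frechet_derivative (f \<circ> chart_inv \<kappa>) (at (snd \<kappa> q)))
    (at (snd \<kappa> q))"
  by (rule smooth_on_has_derivative[of "chart_image \<kappa>"])
    (use assms(1) charts_atD(1)[OF assms(2)] charts_atD(2)[OF assms(2)] in
      \<open>simp_all add: smooth_functions_def\<close>)

lemma differential_in_cotangent_space:
  assumes "smooth_atlas N" "f \<in> smooth_functions N" "q \<in> points N"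
  shows "differential N f q \<in> cotangent_space N q"
  unfolding differential_eq_coord_covec
  by (rule coord_covec_in_cotangent_space[OF assms(1) has_derivative_linear[OF
          smooth_function_has_derivative[OF assms(2) chart_at_in_charts_at[OF assms(1,3)]]]])

text \<open>Chain rule: with this, brackets of pulled back functions are values on pulled back covectors.\<close>

lemma differential_compose:
  assumes M: "smooth_atlas M" and N: "smooth_atlas N" and \<phi>: "smooth_map M N \<phi>"
    and m: "m \<in> points M" and f: "f \<in> smooth_functions N"
  shows "differential M (f \<circ> \<phi>) m = pullback_covec M N \<phi> m (differential N f (\<phi> m))"
proof -
  define \<kappa> \<kappa>' where "\<kappa> = chart_at M m" and "\<kappa>' = chart_at N (\<phi> m)"
  have \<kappa>: "\<kappa> \<in> charts_at M m" and \<kappa>': "\<kappa>' \<in> charts_at N (\<phi> m)"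
    unfolding \<kappa>_def \<kappa>'_def by (rule chart_at_in_charts_at[OF M m],
        rule chart_at_in_charts_at[OF N smooth_map_in_points[OF \<phi> m]])
  note at = charts_atD(1)[OF \<kappa>] charts_atD(1)[OF \<kappa>']
  note mem = charts_atD(2)[OF \<kappa>] charts_atD(2)[OF \<kappa>']
  note ch = charts_at_is_chart[OF M \<kappa>] charts_at_is_chart[OF N \<kappa>']
  define D where "D = frechet_derivative (f \<circ> chart_inv \<kappa>') (at (snd \<kappa>' (\<phi> m)))"
  have "((f \<circ> chart_inv \<kappa>') \<circ> (snd \<kappa>' \<circ> \<phi> \<circ> chart_inv \<kappa>) has_derivative
      D \<circ> local_derivative \<kappa> \<kappa>' \<phi> m) (at (snd \<kappa> m))"
    by (rule diff_chain_at[OF local_derivative_has_derivative[OF \<phi> \<kappa> \<kappa>']])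
      (simp add: chart_inv_chart[OF ch(1) mem(1)] D_def smooth_function_has_derivative[OF f \<kappa>'])
  then have "((f \<circ> \<phi> \<circ> chart_inv \<kappa>) has_derivative D \<circ> local_derivative \<kappa> \<kappa>' \<phi> m) (at (snd \<kappa> m))"
    by (rule has_derivative_transform_within_open[OF _ smooth_map_open[OF M N \<phi> at]])
      (use mem in \<open>auto simp: chart_inv_chart[OF ch(1)] chart_inv_chart[OF ch(2)]\<close>)
  from frechet_derivative_at[OF this]
  show ?thesis
    unfolding differential_eq_coord_covec \<kappa>_def[symmetric] \<kappa>'_def[symmetric]
      pullback_covec_coord_covec[OF M N \<phi> m \<kappa>', folded \<kappa>_def] D_def[symmetric] by simp
qed

text \<open>The bracket condition tests the two fields on differentials of functions, and at each point of
  \<open>N\<close> all covectors are of this form. So the condition becomes pointwise and linear in nature.\<close>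

lemma multivector_map_iff_covectors:
  assumes M: "smooth_atlas M" and "smooth_manifold N" "smooth_map M N \<phi>"
  shows "multivector_map n M PM N PN \<phi> \<longleftrightarrow>
    (\<forall>m\<in>points M. \<forall>\<eta>s. length \<eta>s = n \<and> set \<eta>s \<subseteq> cotangent_space N (\<phi> m) \<longrightarrow>
       PM m (map (pullback_covec M N \<phi> m) \<eta>s) = PN (\<phi> m) \<eta>s)"
proof -
  note N = smooth_manifold_imp_smooth_atlas[OF assms(2)]
  have br: "bracket M PM (map (\<lambda>f. f \<circ> \<phi>) fs) m =
      PM m (map (pullback_covec M N \<phi> m) (map (\<lambda>f. differential N f (\<phi> m)) fs))"
    if "set fs \<subseteq> smooth_functions N" "m \<in> points M" for fs m
  proof -
    have "map (\<lambda>f. differential M f m) (map (\<lambda>f. f \<circ> \<phi>) fs) =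
        map (pullback_covec M N \<phi> m) (map (\<lambda>f. differential N f (\<phi> m)) fs)"
      using that by (auto simp: differential_compose[OF M N assms(3)])
    then show ?thesis by (simp only: bracket_def)
  qed
  show ?thesis
  proof
    assume L: "multivector_map n M PM N PN \<phi>"
    show "\<forall>m\<in>points M. \<forall>\<eta>s. length \<eta>s = n \<and> set \<eta>s \<subseteq> cotangent_space N (\<phi> m) \<longrightarrow>
       PM m (map (pullback_covec M N \<phi> m) \<eta>s) = PN (\<phi> m) \<eta>s"
    proof (intro ballI allI impI)
      fix m \<eta>s assume m: "m \<in> points M" and \<eta>s: "length \<eta>s = n \<and> set \<eta>s \<subseteq> cotangent_space N (\<phi> m)"
      have "\<exists>f. f \<in> smooth_functions N \<and> differential N f (\<phi> m) = \<eta>" if "\<eta> \<in> set \<eta>s" for \<eta>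
      proof -
        have "\<eta> \<in> cotangent_space N (\<phi> m)" using \<eta>s that by blast
        then show ?thesis
          using covector_eq_differential[OF assms(2) smooth_map_in_points[OF assms(3) m]] by metis
      qed
      then obtain F where F: "F \<eta> \<in> smooth_functions N" "differential N (F \<eta>) (\<phi> m) = \<eta>"
        if "\<eta> \<in> set \<eta>s" for \<eta>
        by metis
      have fs: "set (map F \<eta>s) \<subseteq> smooth_functions N" using F(1) by auto
      have eq: "map (\<lambda>f. differential N f (\<phi> m)) (map F \<eta>s) = \<eta>s"
        using F(2) by (simp add: map_idI)
      have "bracket M PM (map (\<lambda>f. f \<circ> \<phi>) (map F \<eta>s)) m = bracket N PN (map F \<eta>s) (\<phi> m)"
        using L fs \<eta>s m unfolding multivector_map_def by (metis length_map)
      then show "PM m (map (pullback_covec M N \<phi> m) \<eta>s) = PN (\<phi> m) \<eta>s"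
        unfolding br[OF fs m] unfolding bracket_def eq .
    qed
  next
    assume R: "\<forall>m\<in>points M. \<forall>\<eta>s. length \<eta>s = n \<and> set \<eta>s \<subseteq> cotangent_space N (\<phi> m) \<longrightarrow>
       PM m (map (pullback_covec M N \<phi> m) \<eta>s) = PN (\<phi> m) \<eta>s"
    show "multivector_map n M PM N PN \<phi>"
      unfolding multivector_map_def
    proof (intro allI impI ballI)
      fix fs m assume fs: "length fs = n \<and> set fs \<subseteq> smooth_functions N" and m: "m \<in> points M"
      have "set (map (\<lambda>f. differential N f (\<phi> m)) fs) \<subseteq> cotangent_space N (\<phi> m)"
        using fs differential_in_cotangent_space[OF N _ smooth_map_in_points[OF assms(3) m]] by auto
      then have "PM m (map (pullback_covec M N \<phi> m) (map (\<lambda>f. differential N f (\<phi> m)) fs)) =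
          PN (\<phi> m) (map (\<lambda>f. differential N f (\<phi> m)) fs)"
        by (intro R[rule_format, OF m] conjI) (simp add: fs)
      then show "bracket M PM (map (\<lambda>f. f \<circ> \<phi>) fs) m = bracket N PN fs (\<phi> m)"
        unfolding br[OF conjunct2[OF fs] m] by (simp only: bracket_def)
    qed
  qed
qed

section \<open>The annihilator of the graph\<close>

lemma uminus_covec_in_cotangent_space:
  "\<alpha> \<in> cotangent_space M p \<Longrightarrow> (\<lambda>v. - \<alpha> v) \<in> cotangent_space M p"
  unfolding cotangent_space_def by (simp add: algebra_simps)

text \<open>By multilinearity each of the \<open>n\<close> arguments contributes a factor \<open>-1\<close>. The induction negates one
  argument at a time, starting from the left.\<close>

lemma multivector_uminus:
  assumes "multivector M n p \<omega>" "length \<alpha>s = n" "set \<alpha>s \<subseteq> cotangent_space M p"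
  shows "\<omega> (map (\<lambda>\<alpha> v. - \<alpha> v) \<alpha>s) = (-1) ^ n * \<omega> \<alpha>s"
proof -
  let ?neg = "\<lambda>(\<alpha> :: ('a, 'b) covec) v. - \<alpha> v"
  have "\<omega> (map ?neg (take k \<alpha>s) @ drop k \<alpha>s) = (-1) ^ k * \<omega> \<alpha>s" if "k \<le> n" for k
    using that
  proof (induction k)
    case (Suc k)
    let ?L = "map ?neg (take k \<alpha>s) @ drop k \<alpha>s" and ?\<beta> = "\<alpha>s ! k"
    have k: "k < n" using Suc by simp
    have \<beta>: "?\<beta> \<in> cotangent_space M p" using assms(2,3) k by auto
    have "set ?L \<subseteq> cotangent_space M p"
      using assms(3) by (auto dest: in_set_takeD in_set_dropD intro!: uminus_covec_in_cotangent_space)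
    moreover have "length ?L = n" using assms(2) k by simp
    \<comment> \<open>Negation is the linear combination with coefficients \<open>-1\<close> and \<open>0\<close>.\<close>
    ultimately have "\<omega> (?L[k := (\<lambda>v. (-1) * ?\<beta> v + 0 * ?\<beta> v)]) =
        (-1) * \<omega> (?L[k := ?\<beta>]) + 0 * \<omega> (?L[k := ?\<beta>])"
      using assms(1) k \<beta> unfolding multivector_def by blast
    moreover have "?L[k := x] = map ?neg (take k \<alpha>s) @ x # drop (Suc k) \<alpha>s" for x
      using k assms(2) by (simp add: list_update_append min_absorb2 Cons_nth_drop_Suc[symmetric])
    moreover have "map ?neg (take k \<alpha>s) @ ?neg ?\<beta> # drop (Suc k) \<alpha>s =
        map ?neg (take (Suc k) \<alpha>s) @ drop (Suc k) \<alpha>s"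
      using k assms(2) by (simp add: take_Suc_conv_app_nth)
    moreover have "map ?neg (take k \<alpha>s) @ ?\<beta> # drop (Suc k) \<alpha>s = ?L"
      using k assms(2) by (simp add: Cons_nth_drop_Suc)
    ultimately show ?case using Suc by simp
  qed simp
  from this[of n] show ?thesis using assms(2) by simp
qed

text \<open>A covector at \<open>(m, \<phi> m)\<close> is determined by its restrictions \<open>\<beta>\<close> and \<open>\<eta>\<close> to the two factors. In the
  coordinates of \<open>K\<close> it is a functional \<open>A\<close>, and the restrictions are \<open>w \<mapsto> A (w, 0)\<close> and \<open>z \<mapsto> A (0, z)\<close>.
  It annihilates the graph iff \<open>A (w, D w) = 0\<close> for all \<open>w\<close>, where \<open>D\<close> is the derivative of \<open>\<phi>\<close>, and this
  says \<open>\<beta> = - \<phi>\<^sup>*\<eta>\<close>.\<close>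

context
  fixes M :: "('a, 'e::real_inner) manifold" and N :: "('b, 'f::real_inner) manifold" and \<phi> m P \<kappa> \<kappa>' K
  assumes M: "smooth_atlas M" and N: "smooth_atlas N" and \<phi>: "smooth_map M N \<phi>" and m: "m \<in> points M"
  defines P_def: "P \<equiv> prod_manifold M N"
    and \<kappa>_def: "\<kappa> \<equiv> chart_at M m" and \<kappa>'_def: "\<kappa>' \<equiv> chart_at N (\<phi> m)"
    and K_def: "K \<equiv> prod_chart \<kappa> \<kappa>'"
begin

private lemma P: "smooth_atlas P"
  unfolding P_def by (rule smooth_atlas_prod[OF M N])

private lemma \<kappa>: "\<kappa> \<in> charts_at M m" and \<phi>m: "\<phi> m \<in> points N" and \<kappa>': "\<kappa>' \<in> charts_at N (\<phi> m)"
proof -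
  show "\<phi> m \<in> points N" by (rule smooth_map_in_points[OF \<phi> m])
  then show "\<kappa>' \<in> charts_at N (\<phi> m)" unfolding \<kappa>'_def by (rule chart_at_in_charts_at[OF N])
  show "\<kappa> \<in> charts_at M m" unfolding \<kappa>_def by (rule chart_at_in_charts_at[OF M m])
qed

private lemma K: "K \<in> charts_at P (m, \<phi> m)"
  unfolding K_def P_def by (rule prod_chart_in_charts_at[OF \<kappa> \<kappa>'])

private lemma restrict_to_first_factor:
  "pullback_covec M P (\<lambda>x. (x, \<phi> m)) m (coord_covec P (m, \<phi> m) K A) = coord_covec M m \<kappa> (\<lambda>w. A (w, 0))"
proof -
  have s: "smooth_map M P (\<lambda>x. (x, \<phi> m))"
    unfolding P_def
    by (rule smooth_map_Pair[OF M M N smooth_map_id[OF M] smooth_map_const[OF M \<phi>m]])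
  have "local_derivative \<kappa> K (\<lambda>x. (x, \<phi> m)) m = (\<lambda>w. (w, 0))"
    unfolding K_def local_derivative_Pair[OF smooth_map_id[OF M] smooth_map_const[OF M \<phi>m] \<kappa> \<kappa> \<kappa>']
      local_derivative_id[OF M \<kappa>] local_derivative_const ..
  then show ?thesis
    using pullback_covec_coord_covec[OF M P s m K, of A] unfolding \<kappa>_def[symmetric] o_def by (simp only:)
qed

private lemma restrict_to_second_factor:
  "pullback_covec N P (\<lambda>y. (m, y)) (\<phi> m) (coord_covec P (m, \<phi> m) K A) =
    coord_covec N (\<phi> m) \<kappa>' (\<lambda>z. A (0, z))"
proof -
  have s: "smooth_map N P (\<lambda>y. (m, y))"
    unfolding P_def
    by (rule smooth_map_Pair[OF N M N smooth_map_const[OF N m] smooth_map_id[OF N]])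
  have "local_derivative \<kappa>' K (\<lambda>y. (m, y)) (\<phi> m) = (\<lambda>z. (0, z))"
    unfolding K_def local_derivative_Pair[OF smooth_map_const[OF N m] smooth_map_id[OF N] \<kappa>' \<kappa> \<kappa>']
      local_derivative_id[OF N \<kappa>'] local_derivative_const ..
  then show ?thesis
    using pullback_covec_coord_covec[OF N P s \<phi>m K, of A] unfolding \<kappa>'_def[symmetric] o_def by (simp only:)
qed

private lemma coord_covec_in_annihilator_graph:
  assumes "linear A"
  shows "coord_covec P (m, \<phi> m) K A \<in> annihilator P (graph_of M \<phi>) (m, \<phi> m) \<longleftrightarrow>
    (\<forall>w. A (w, local_derivative \<kappa> \<kappa>' \<phi> m w) = 0)"
proof
  assume L: "coord_covec P (m, \<phi> m) K A \<in> annihilator P (graph_of M \<phi>) (m, \<phi> m)"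
  show "\<forall>w. A (w, local_derivative \<kappa> \<kappa>' \<phi> m w) = 0"
  proof
    fix w
    define v where "v = tangent_vector P (m, \<phi> m) K (w, local_derivative \<kappa> \<kappa>' \<phi> m w)"
    have v: "v \<in> tangent_space P (m, \<phi> m)" "v K = (w, local_derivative \<kappa> \<kappa>' \<phi> m w)"
      unfolding v_def by (rule tangent_vector_in_tangent_space[OF P K], rule tangent_vector_same_chart[OF P K])
    then have "v \<in> submanifold_tangent_space P (graph_of M \<phi>) (m, \<phi> m)"
      unfolding submanifold_tangent_space_graph[OF M N \<phi> m \<kappa> \<kappa>', folded P_def K_def] by simp
    then have "coord_covec P (m, \<phi> m) K A v = 0" using L by (simp add: annihilator_def)
    then show "A (w, local_derivative \<kappa> \<kappa>' \<phi> m w) = 0" using v by (simp add: coord_covec_def)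
  qed
next
  assume R: "\<forall>w. A (w, local_derivative \<kappa> \<kappa>' \<phi> m w) = 0"
  have "coord_covec P (m, \<phi> m) K A v = 0"
    if "v \<in> submanifold_tangent_space P (graph_of M \<phi>) (m, \<phi> m)" for v
  proof -
    have "snd (v K) = local_derivative \<kappa> \<kappa>' \<phi> m (fst (v K))"
      using that unfolding submanifold_tangent_space_graph[OF M N \<phi> m \<kappa> \<kappa>', folded P_def K_def] by blast
    then have "A (v K) = 0" using R by (metis prod.collapse)
    then show ?thesis by (simp add: coord_covec_def)
  qed
  then show "coord_covec P (m, \<phi> m) K A \<in> annihilator P (graph_of M \<phi>) (m, \<phi> m)"
    using coord_covec_in_cotangent_space[OF P assms] by (simp add: annihilator_def)
qed

text \<open>The value of a covector of the annihilator on \<open>(w, D w) = (w, 0) + (0, D w)\<close> is \<open>0\<close>, so its first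
  restriction is determined by its second.\<close>

lemma annihilator_graph_restrictions:
  assumes "\<alpha> \<in> annihilator P (graph_of M \<phi>) (m, \<phi> m)"
  defines "\<eta> \<equiv> pullback_covec N P (\<lambda>y. (m, y)) (\<phi> m) \<alpha>"
  shows "\<eta> \<in> cotangent_space N (\<phi> m)"
    and "pullback_covec M P (\<lambda>x. (x, \<phi> m)) m \<alpha> = (\<lambda>v. - pullback_covec M N \<phi> m \<eta> v)"
proof -
  have "\<alpha> \<in> cotangent_space P (m, \<phi> m)" using assms(1) by (simp add: annihilator_def)
  then obtain A where A: "linear A" "\<alpha> = coord_covec P (m, \<phi> m) K A"
    by (rule cotangent_space_eq_coord_covec[OF P K])
  have ann: "A (w, local_derivative \<kappa> \<kappa>' \<phi> m w) = 0" for w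
    using assms(1) coord_covec_in_annihilator_graph[OF A(1)] unfolding A(2) by blast
  have \<eta>: "\<eta> = coord_covec N (\<phi> m) \<kappa>' (\<lambda>z. A (0, z))"
    unfolding \<eta>_def A(2) by (rule restrict_to_second_factor)
  have "linear (\<lambda>z::'f. (0::'e, z))" by (auto intro!: linearI)
  from linear_compose[OF this A(1)] show "\<eta> \<in> cotangent_space N (\<phi> m)"
    unfolding \<eta> by (intro coord_covec_in_cotangent_space[OF N]) (simp add: o_def)
  have split: "A (w, 0) = - A (0, local_derivative \<kappa> \<kappa>' \<phi> m w)" for w
    using linear_add[OF A(1), of "(w, 0)" "(0, local_derivative \<kappa> \<kappa>' \<phi> m w)"] ann[of w] by simp
  show "pullback_covec M P (\<lambda>x. (x, \<phi> m)) m \<alpha> = (\<lambda>v. - pullback_covec M N \<phi> m \<eta> v)"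
    unfolding A(2) restrict_to_first_factor unfolding \<eta> pullback_covec_coord_covec[OF M N \<phi> m \<kappa>', folded \<kappa>_def]
    by (simp add: coord_covec_def split fun_eq_iff)
qed

text \<open>The second restriction is arbitrary: \<open>(w, z) \<mapsto> B z - B (D w)\<close> kills the graph of \<open>D\<close> and restricts
  to \<open>B\<close>.\<close>

lemma covector_extends_to_annihilator_graph:
  assumes "\<eta> \<in> cotangent_space N (\<phi> m)"
  obtains \<alpha> where "\<alpha> \<in> annihilator P (graph_of M \<phi>) (m, \<phi> m)"
    "pullback_covec N P (\<lambda>y. (m, y)) (\<phi> m) \<alpha> = \<eta>"
proof -
  obtain B where B: "linear B" "\<eta> = coord_covec N (\<phi> m) \<kappa>' B"
    by (rule cotangent_space_eq_coord_covec[OF N \<kappa>' assms])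
  let ?D = "local_derivative \<kappa> \<kappa>' \<phi> m"
  have D: "linear ?D" by (rule linear_local_derivative[OF \<phi> \<kappa> \<kappa>'])
  define A where "A = (\<lambda>e. B (snd e) - B (?D (fst e)))"
  have "linear A"
    by (rule linearI) (simp_all add: A_def linear_add[OF B(1)] linear_cmul[OF B(1)]
        linear_add[OF D] linear_cmul[OF D] algebra_simps)
  then have "coord_covec P (m, \<phi> m) K A \<in> annihilator P (graph_of M \<phi>) (m, \<phi> m)"
    by (subst coord_covec_in_annihilator_graph) (simp_all add: A_def)
  moreover have "(\<lambda>z. A (0, z)) = B"
    by (simp add: A_def linear_0[OF D] linear_0[OF B(1)])
  then have "pullback_covec N P (\<lambda>y. (m, y)) (\<phi> m) (coord_covec P (m, \<phi> m) K A) = \<eta>"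
    unfolding restrict_to_second_factor B(2) by simp
  ultimately show thesis by (rule that)
qed

end

section \<open>Morphisms of manifolds with multivector fields\<close>

theorem proposition3p5:
  fixes M :: "('a, 'e::real_inner) manifold"
    and N :: "('b, 'f::real_inner) manifold"
    and n :: nat
    and PM :: "('a, 'e) mvfield"
    and PN :: "('b, 'f) mvfield"
    and \<phi> :: "'a \<Rightarrow> 'b"
  assumes "smooth_manifold M"
    and "smooth_manifold N"
    and "multivector_field M n PM"
    and "multivector_field N n PN"
    and "smooth_map M N \<phi>"
  shows "multivector_map n M PM N PN \<phi> \<longleftrightarrow>
    coisotropic_submanifold n (prod_manifold M N)
      (prod_mvfield M N PM (scale_mvfield ((-1) powi (int n - 1)) PN))
      (graph_of M \<phi>)"
proof -
  note M = smooth_manifold_imp_smooth_atlas[OF assms(1)]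
  note N = smooth_manifold_imp_smooth_atlas[OF assms(2)]
  define Q where "Q = prod_mvfield M N PM (scale_mvfield ((-1) powi (int n - 1)) PN)"
  let ?ann = "\<lambda>m. annihilator (prod_manifold M N) (graph_of M \<phi>) (m, \<phi> m)"
  let ?i = "\<lambda>m. pullback_covec N (prod_manifold M N) (\<lambda>y. (m, y)) (\<phi> m)"
  let ?j = "\<lambda>m. pullback_covec M (prod_manifold M N) (\<lambda>x. (x, \<phi> m)) m"
  let ?p = "pullback_covec M N \<phi>"
  \<comment> \<open>The exponent is an integer, so this holds for \<open>n = 0\<close> as well.\<close>
  have sign: "(-1) powi (int n - 1) = - ((-1::real) ^ n)"
    by (simp add: power_int_diff)
  \<comment> \<open>The first summand of \<open>Q\<close> acquires \<open>(-1) ^ n\<close> from \<open>\<beta> = - \<phi>\<^sup>*\<eta>\<close>, the second carries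
    \<open>(-1) powi (n - 1)\<close>; the signs differ by \<open>-1\<close>, so \<open>Q\<close> measures the defect of \<open>\<phi>\<close>.\<close>
  have Q: "Q (m, \<phi> m) \<alpha>s = (-1) ^ n * (PM m (map (?p m) \<eta>s) - PN (\<phi> m) \<eta>s)"
    if m: "m \<in> points M" and \<alpha>s: "length \<alpha>s = n" "set \<alpha>s \<subseteq> ?ann m" "\<eta>s = map (?i m) \<alpha>s" for m \<alpha>s \<eta>s
  proof -
    have ann: "\<alpha> \<in> ?ann m" if "\<alpha> \<in> set \<alpha>s" for \<alpha> using \<alpha>s(2) that by blast
    have eq: "map (?j m) \<alpha>s = map (\<lambda>\<alpha> v. - \<alpha> v) (map (?p m) \<eta>s)"
      unfolding \<alpha>s(3) using annihilator_graph_restrictions(2)[OF M N assms(5) m ann] by simp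
    have cot: "set (map (?p m) \<eta>s) \<subseteq> cotangent_space M m"
      unfolding \<alpha>s(3)
      using pullback_covec_in_cotangent_space[OF M N assms(5) m
          annihilator_graph_restrictions(1)[OF M N assms(5) m ann]] by auto
    have mv: "multivector M n m (PM m)"
      using assms(3) m by (simp add: multivector_field_def)
    have "PM m (map (?j m) \<alpha>s) = (-1) ^ n * PM m (map (?p m) \<eta>s)"
      unfolding eq by (rule multivector_uminus[OF mv _ cot]) (simp add: \<alpha>s(1,3))
    then have "Q (m, \<phi> m) \<alpha>s = (-1) ^ n * PM m (map (?p m) \<eta>s) + - ((-1) ^ n) * PN (\<phi> m) \<eta>s"
      unfolding Q_def prod_mvfield_def scale_mvfield_def sign \<alpha>s(3) split_conv by (simp only:)
    then show ?thesis by (simp add: right_diff_distrib)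
  qed
  have "coisotropic_submanifold n (prod_manifold M N) Q (graph_of M \<phi>) \<longleftrightarrow>
    (\<forall>m\<in>points M. \<forall>\<alpha>s. length \<alpha>s = n \<and> set \<alpha>s \<subseteq> ?ann m \<longrightarrow> Q (m, \<phi> m) \<alpha>s = 0)"
    using embedded_submanifold_graph[OF M N assms(5)]
    by (auto simp: coisotropic_submanifold_def graph_of_def)
  also have "\<dots> \<longleftrightarrow> (\<forall>m\<in>points M. \<forall>\<eta>s. length \<eta>s = n \<and> set \<eta>s \<subseteq> cotangent_space N (\<phi> m) \<longrightarrow>
       PM m (map (?p m) \<eta>s) = PN (\<phi> m) \<eta>s)"
  proof (intro ball_cong refl iffI allI impI)
    fix m \<eta>s assume m: "m \<in> points M"
      and L: "\<forall>\<alpha>s. length \<alpha>s = n \<and> set \<alpha>s \<subseteq> ?ann m \<longrightarrow> Q (m, \<phi> m) \<alpha>s = 0"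
      and \<eta>s: "length \<eta>s = n \<and> set \<eta>s \<subseteq> cotangent_space N (\<phi> m)"
    have "\<exists>\<alpha>. \<alpha> \<in> ?ann m \<and> ?i m \<alpha> = \<eta>" if "\<eta> \<in> set \<eta>s" for \<eta>
    proof -
      have "\<eta> \<in> cotangent_space N (\<phi> m)" using \<eta>s that by blast
      then show ?thesis using covector_extends_to_annihilator_graph[OF M N assms(5) m] by metis
    qed
    then obtain E where E: "E \<eta> \<in> ?ann m" "?i m (E \<eta>) = \<eta>" if "\<eta> \<in> set \<eta>s" for \<eta>
      by metis
    have "set (map E \<eta>s) \<subseteq> ?ann m" "length (map E \<eta>s) = n" using E(1) \<eta>s by auto
    moreover have "\<eta>s = map (?i m) (map E \<eta>s)" using E(2) by (simp add: map_idI)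
    ultimately have "(-1) ^ n * (PM m (map (?p m) \<eta>s) - PN (\<phi> m) \<eta>s) = 0"
      using Q[OF m, of "map E \<eta>s" \<eta>s] L by metis
    then show "PM m (map (?p m) \<eta>s) = PN (\<phi> m) \<eta>s" by simp
  next
    fix m \<alpha>s assume m: "m \<in> points M"
      and R: "\<forall>\<eta>s. length \<eta>s = n \<and> set \<eta>s \<subseteq> cotangent_space N (\<phi> m) \<longrightarrow>
        PM m (map (?p m) \<eta>s) = PN (\<phi> m) \<eta>s"
      and \<alpha>s: "length \<alpha>s = n \<and> set \<alpha>s \<subseteq> ?ann m"
    have "set (map (?i m) \<alpha>s) \<subseteq> cotangent_space N (\<phi> m)"
      using \<alpha>s annihilator_graph_restrictions(1)[OF M N assms(5) m] by auto
    then have "PM m (map (?p m) (map (?i m) \<alpha>s)) = PN (\<phi> m) (map (?i m) \<alpha>s)"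
      using R \<alpha>s by (metis length_map)
    then show "Q (m, \<phi> m) \<alpha>s = 0"
      using Q[OF m conjunct1[OF \<alpha>s] conjunct2[OF \<alpha>s] refl] by simp
  qed
  finally show ?thesis
    unfolding Q_def[symmetric] multivector_map_iff_covectors[OF M assms(2,5)] by blast
qed

end
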